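(* Let $\mathcal{W}$ be the Lie algebra $W(2,2)$. For any $\lambda\in\mathbb{C}^*$, $\alpha\in\mathbb{C}$ and $\mathbf{h}=\{h_n(t)\}_{n\in\mathbb{Z}}\in\mathcal{H}_\alpha$, let $\Omega(\lambda,\alpha,\mathbf{h})=\mathbb{C}[t,s]$ with operators defined, for $f(t,s)\in\mathbb{C}[t,s]$ and $m\in\mathbb{Z}$, by $$C_1\big(f(t,s)\big)=C_2\big(f(t,s)\big)=0,\qquad W_m\big(f(t,s)\big)=\lambda^m(t-m\alpha)f(t,s-m),$$ $$L_m\big(f(t,s)\big)=\lambda^m\big(s+h_m(t)\big)f(t,s-m)-m\lambda^m(t-m\alpha)\frac{\partial}{\partial t}\big(f(t,s-m)\big).$$ Then these operators make $\Omega(\lambda,\alpha,\mathbf{h})$ a $\mathcal{W}$-module, and $\Omega(\lambda,\alpha,\mathbf{h})$ is free of rank $1$ as a module over $U(\mathbb{C}L_0\oplus\mathbb{C}W_0)$. Moreover, $\Omega(\lambda,\alpha,\mathbf{h})$ is simple as a $\mathcal{W}$-module if and only if $\alpha\neq 0$.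
   Context: $\mathbb{C}^*=\mathbb{C}\setminus\{0\}$, and $U(\cdot)$ denotes the universal enveloping algebra. The Lie algebra $\mathcal{W}=W(2,2)$ is the complex Lie algebra with basis $\{L_n, W_n, C_1, C_2\mid n\in\mathbb{Z}\}$ and brackets, for all $m,n\in\mathbb{Z}$, $$[L_m,L_n]=(n-m)L_{m+n}+\delta_{m+n,0}\frac{m^3-m}{12}C_1,$$ $$[L_m,W_n]=(n-m)W_{m+n}+\delta_{m+n,0}\frac{m^3-m}{12}C_2,$$ $$[W_m,W_n]=0,$$ where $C_1,C_2$ are central. For $\alpha\in\mathbb{C}$, an integer $k\geq 0$ and $n\in\mathbb{Z}$, define the polynomial $$h_{n,k;\alpha}(t)=nt^k-n(n-1)\alpha\,\frac{t^k-\alpha^k}{t-\alpha}\in\mathbb{C}[t]$$ (the quotient is the polynomial $\sum_{j=0}^{k-1}t^{j}\alpha^{k-1-j}$, which is $0$ for $k=0$, so $h_{n,0;\alpha}(t)=n$). Let $\mathcal{H}_\alpha$ be the set of families of polynomials $\{h_n(t)\}_{n\in\mathbb{Z}}$ of the form $h_n(t)=\sum_{i=0}^{\infty}\xi_i h_{n,i;\alpha}(t)\in\mathbb{C}[t]$ for all $n\in\mathbb{Z}$, where the coefficients $\xi_i\in\mathbb{C}$ are independent of $n$ and only finitely many of them are nonzero. In particular $\mathcal{H}_0=\{\{nh(t)\}_{n\in\mathbb{Z}}\mid h(t)\in\mathbb{C}[t]\}$. *)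

theory Defs
  imports
    Complex_Main
    "HOL-Library.FuncSet"
    "HOL-Library.Poly_Mapping"
    "HOL-Computational_Algebra.Polynomial"
    "HOL-Algebra.QuotRing"
begin

section \<open>Lie algebras and their modules\<close>

locale lie_algebra = g: vector_space sg
  for sg :: "'k::field \<Rightarrow> 'g::ab_group_add \<Rightarrow> 'g" +
  fixes br :: "'g \<Rightarrow> 'g \<Rightarrow> 'g"
  assumes br_add_left: "br (x + y) z = br x z + br y z"
    and br_add_right: "br x (y + z) = br x y + br x z"
    and br_scale_left: "br (sg c x) y = sg c (br x y)"
    and br_scale_right: "br x (sg c y) = sg c (br x y)"
    and br_self: "br x x = 0"
    and jacobi: "br x (br y z) + br y (br z x) + br z (br x y) = 0"

definition (in lie_algebra) lie_subalgebra :: "'g set \<Rightarrow> bool" where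
  "lie_subalgebra H \<longleftrightarrow> g.subspace H \<and> (\<forall>x\<in>H. \<forall>y\<in>H. br x y \<in> H)"

locale lie_module = lie_algebra sg br + M: vector_space sm
  for sg :: "'k::field \<Rightarrow> 'g::ab_group_add \<Rightarrow> 'g"
    and br :: "'g \<Rightarrow> 'g \<Rightarrow> 'g"
    and sm :: "'k \<Rightarrow> 'm::ab_group_add \<Rightarrow> 'm" +
  fixes \<rho> :: "'g \<Rightarrow> 'm \<Rightarrow> 'm"
  assumes act_add_left: "\<rho> (x + y) v = \<rho> x v + \<rho> y v"
    and act_add_right: "\<rho> x (u + v) = \<rho> x u + \<rho> x v"
    and act_scale_left: "\<rho> (sg c x) v = sm c (\<rho> x v)"
    and act_scale_right: "\<rho> x (sm c v) = sm c (\<rho> x v)"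
    and act_bracket: "\<rho> (br x y) v = \<rho> x (\<rho> y v) - \<rho> y (\<rho> x v)"
begin

definition lie_submodule :: "'m set \<Rightarrow> bool" where
  "lie_submodule N \<longleftrightarrow> M.subspace N \<and> (\<forall>x. \<forall>v\<in>N. \<rho> x v \<in> N)"

definition simple :: bool where
  "simple \<longleftrightarrow> (\<exists>v::'m. v \<noteq> 0) \<and> (\<forall>N. lie_submodule N \<longrightarrow> N = {0} \<or> N = UNIV)"

end


section \<open>Modules over noncommutative rings\<close>

text \<open>The locale of \<open>HOL-Algebra.Module\<close> requires a commutative ring.\<close>

locale left_module = ring R for R :: "('r, 'b) ring_scheme" (structure) +
  fixes act :: "'r \<Rightarrow> 'm::ab_group_add \<Rightarrow> 'm"
  assumes act_add_left: "\<lbrakk>r \<in> carrier R; r' \<in> carrier R\<rbrakk> \<Longrightarrow> act (r \<oplus> r') v = act r v + act r' v"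
    and act_add_right: "r \<in> carrier R \<Longrightarrow> act r (u + v) = act r u + act r v"
    and act_mult: "\<lbrakk>r \<in> carrier R; r' \<in> carrier R\<rbrakk> \<Longrightarrow> act (r \<otimes> r') v = act r (act r' v)"
    and act_one: "act \<one> v = v"
begin

definition finite_basis :: "'m set \<Rightarrow> bool" where
  "finite_basis B \<longleftrightarrow>
     finite B \<and> (\<forall>v. \<exists>!c. c \<in> B \<rightarrow>\<^sub>E carrier R \<and> v = (\<Sum>b\<in>B. act (c b) b))"

definition free_of_rank :: "nat \<Rightarrow> bool" where
  "free_of_rank n \<longleftrightarrow> (\<exists>B. finite_basis B \<and> card B = n)"

end


section \<open>Universal enveloping algebras\<close>

text \<open>Lists form the free monoid, so \<open>'g list \<Rightarrow>\<^sub>0 'k\<close> with the convolution product of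
  \<open>HOL-Library.Poly_Mapping\<close> is the free associative algebra on \<open>'g\<close>.\<close>

instantiation list :: (type) monoid_add
begin

definition zero_list :: "'a list" where "zero_list = []"
definition plus_list :: "'a list \<Rightarrow> 'a list \<Rightarrow> 'a list" where "plus_list xs ys = xs @ ys"

instance by standard (simp_all add: zero_list_def plus_list_def)

end

definition free_algebra :: "'g set \<Rightarrow> ('g list \<Rightarrow>\<^sub>0 'k::field) ring" where
  "free_algebra H =
     \<lparr>carrier = {p. Poly_Mapping.keys p \<subseteq> lists H}, mult = (*), one = 1, zero = 0, add = (+)\<rparr>"

text \<open>The linearity relations turn the free algebra on the set \<open>H\<close> into the tensor algebra of the
  vector space \<open>H\<close>; the commutator relations then give the enveloping algebra. \<open>H\<close> is meant to be
  a Lie subalgebra.\<close>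

definition (in lie_algebra) enveloping_relations :: "'g set \<Rightarrow> ('g list \<Rightarrow>\<^sub>0 'k) set" where
  "enveloping_relations H =
     {Poly_Mapping.single [sg a x + sg b y] 1 - Poly_Mapping.single [x] a
        - Poly_Mapping.single [y] b | a b x y. x \<in> H \<and> y \<in> H} \<union>
     {Poly_Mapping.single [x, y] 1 - Poly_Mapping.single [y, x] 1
        - Poly_Mapping.single [br x y] 1 | x y. x \<in> H \<and> y \<in> H}"

definition (in lie_algebra) enveloping_algebra :: "'g set \<Rightarrow> ('g list \<Rightarrow>\<^sub>0 'k) set ring" where
  "enveloping_algebra H =
     free_algebra H Quot (Idl\<^bsub>free_algebra H\<^esub> (enveloping_relations H))"

definition linear_extension ::
  "('k::field \<Rightarrow> 'm::ab_group_add \<Rightarrow> 'm) \<Rightarrow> ('a \<Rightarrow> 'm) \<Rightarrow> ('a \<Rightarrow>\<^sub>0 'k) \<Rightarrow> 'm" where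
  "linear_extension s f x = (\<Sum>a\<in>Poly_Mapping.keys x. s (Poly_Mapping.lookup x a) (f a))"

text \<open>The word \<open>[x\<^sub>1, \<dots>, x\<^sub>n]\<close> acts as \<open>\<rho> x\<^sub>1 \<circ> \<dots> \<circ> \<rho> x\<^sub>n\<close>; a residue class acts by the common
  value of its representatives.\<close>

definition (in lie_module) free_algebra_act :: "('g list \<Rightarrow>\<^sub>0 'k) \<Rightarrow> 'm \<Rightarrow> 'm" where
  "free_algebra_act p v = linear_extension sm (\<lambda>w. foldr \<rho> w v) p"

definition (in lie_module) enveloping_act :: "('g list \<Rightarrow>\<^sub>0 'k) set \<Rightarrow> 'm \<Rightarrow> 'm" where
  "enveloping_act X v = (THE u. \<forall>p\<in>X. free_algebra_act p v = u)"


section \<open>The Lie algebra \<open>W(2,2)\<close>\<close>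

datatype w22_basis = L int | W int | C1 | C2

type_synonym w22 = "w22_basis \<Rightarrow>\<^sub>0 complex"

definition w22_scale :: "complex \<Rightarrow> w22 \<Rightarrow> w22" where
  "w22_scale c x = Poly_Mapping.map ((*) c) x"

abbreviation w22_elem :: "w22_basis \<Rightarrow> w22" where
  "w22_elem a \<equiv> Poly_Mapping.single a 1"

definition w22_cocycle :: "int \<Rightarrow> int \<Rightarrow> complex" where
  "w22_cocycle m n = (if m + n = 0 then of_int (m ^ 3 - m) / 12 else 0)"

fun w22_basis_bracket :: "w22_basis \<Rightarrow> w22_basis \<Rightarrow> w22" where
  "w22_basis_bracket (L m) (L n) =
     w22_scale (of_int (n - m)) (w22_elem (L (m + n))) + w22_scale (w22_cocycle m n) (w22_elem C1)"
| "w22_basis_bracket (L m) (W n) =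
     w22_scale (of_int (n - m)) (w22_elem (W (m + n))) + w22_scale (w22_cocycle m n) (w22_elem C2)"
| "w22_basis_bracket (W m) (L n) =
     - (w22_scale (of_int (m - n)) (w22_elem (W (m + n))) + w22_scale (w22_cocycle n m) (w22_elem C2))"
| "w22_basis_bracket _ _ = 0"

definition w22_bracket :: "w22 \<Rightarrow> w22 \<Rightarrow> w22" where
  "w22_bracket x y =
     linear_extension w22_scale (\<lambda>a. linear_extension w22_scale (w22_basis_bracket a) y) x"

lemma lookup_w22_scale [simp]: "Poly_Mapping.lookup (w22_scale c x) a = c * Poly_Mapping.lookup x a"
  unfolding w22_scale_def by (simp add: Poly_Mapping.map.rep_eq when_def)

lemma vector_space_w22: "vector_space w22_scale"
  by standard (auto intro!: poly_mapping_eqI simp: lookup_add algebra_simps)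

interpretation w22: vector_space w22_scale
  by (rule vector_space_w22)

context vector_space
begin

lemma linear_extension_superset:
  assumes "finite A" "Poly_Mapping.keys x \<subseteq> A"
  shows "linear_extension scale f x = (\<Sum>a\<in>A. scale (Poly_Mapping.lookup x a) (f a))"
  unfolding linear_extension_def
  by (rule sum.mono_neutral_left) (use assms in \<open>auto simp: in_keys_iff\<close>)

lemma linear_extension_add:
  "linear_extension scale f (x + y) = linear_extension scale f x + linear_extension scale f y"
proof -
  let ?A = "Poly_Mapping.keys x \<union> Poly_Mapping.keys y"
  have "Poly_Mapping.keys (x + y) \<subseteq> ?A" by (rule Poly_Mapping.keys_add)
  then show ?thesis
    by (simp add: linear_extension_superset[of ?A] lookup_add scale_left_distrib sum.distrib)
qed

lemma linear_extension_single [simp]: "linear_extension scale f (Poly_Mapping.single a c) = scale c (f a)"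
  by (simp add: linear_extension_superset[of "{a}"])

lemma linear_extension_add_fun:
  "linear_extension scale (\<lambda>a. f a + g a) x = linear_extension scale f x + linear_extension scale g x"
  by (simp add: linear_extension_def scale_right_distrib sum.distrib)

lemma linear_extension_scale_fun:
  "linear_extension scale (\<lambda>a. scale c (f a)) x = scale c (linear_extension scale f x)"
  by (simp add: linear_extension_def scale_sum_right mult.commute)

end

lemma linear_extension_w22_scale:
  assumes "vector_space s"
  shows "linear_extension s f (w22_scale c x) = s c (linear_extension s f x)"
proof -
  interpret vector_space s by fact
  have "Poly_Mapping.keys (w22_scale c x) \<subseteq> Poly_Mapping.keys x"
    by (auto simp: in_keys_iff)
  then show ?thesis
    by (simp add: linear_extension_superset[of "Poly_Mapping.keys x"] scale_sum_right)
qed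

lemma w22_expand: "x = (\<Sum>a\<in>Poly_Mapping.keys x. w22_scale (Poly_Mapping.lookup x a) (w22_elem a))"
proof (rule poly_mapping_eqI)
  fix b
  have "Poly_Mapping.lookup (\<Sum>a\<in>Poly_Mapping.keys x. w22_scale (Poly_Mapping.lookup x a) (w22_elem a)) b
      = (\<Sum>a\<in>Poly_Mapping.keys x. if a = b then Poly_Mapping.lookup x a else 0)"
    unfolding lookup_sum by (rule sum.cong) (auto simp: lookup_single when_def)
  also have "\<dots> = Poly_Mapping.lookup x b"
    by (simp add: in_keys_iff)
  finally show "Poly_Mapping.lookup x b = Poly_Mapping.lookup (\<Sum>a\<in>Poly_Mapping.keys x. w22_scale (Poly_Mapping.lookup x a) (w22_elem a)) b"
    by simp
qed

lemma w22_linear_zero: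
  fixes F :: "w22 \<Rightarrow> w22"
  assumes "\<And>x y. F (x + y) = F x + F y" "\<And>c x. F (w22_scale c x) = w22_scale c (F x)"
    and "\<And>a. F (w22_elem a) = 0"
  shows "F x = 0"
proof -
  have F0: "F 0 = 0" using assms(1)[of 0 0] by simp
  have "F (sum g A) = (\<Sum>a\<in>A. F (g a))" for g and A :: "w22_basis set"
    by (induction A rule: infinite_finite_induct) (simp_all add: F0 assms(1))
  then have "F x = (\<Sum>a\<in>Poly_Mapping.keys x. w22_scale (Poly_Mapping.lookup x a) (F (w22_elem a)))"
    by (subst w22_expand) (simp add: assms(2))
  then show ?thesis by (simp add: assms(3))
qed

lemma w22_bracket_add_left: "w22_bracket (x + y) z = w22_bracket x z + w22_bracket y z"
  by (simp add: w22_bracket_def w22.linear_extension_add)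

lemma w22_bracket_add_right: "w22_bracket x (y + z) = w22_bracket x y + w22_bracket x z"
  by (simp add: w22_bracket_def w22.linear_extension_add w22.linear_extension_add_fun)

lemma w22_bracket_scale_left: "w22_bracket (w22_scale c x) y = w22_scale c (w22_bracket x y)"
  by (simp add: w22_bracket_def linear_extension_w22_scale vector_space_w22)

lemma w22_bracket_scale_right: "w22_bracket x (w22_scale c y) = w22_scale c (w22_bracket x y)"
  by (simp add: w22_bracket_def linear_extension_w22_scale vector_space_w22
      w22.linear_extension_scale_fun)

lemma w22_bracket_basis: "w22_bracket (w22_elem a) (w22_elem b) = w22_basis_bracket a b"
  by (simp add: w22_bracket_def)

lemmas w22_bracket_linear =
  w22_bracket_add_left w22_bracket_add_right w22_bracket_scale_left w22_bracket_scale_right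

lemma w22_bracket_minus_left: "w22_bracket (- x) y = - w22_bracket x y"
  and w22_bracket_minus_right: "w22_bracket x (- y) = - w22_bracket x y"
  and w22_bracket_zero_left: "w22_bracket 0 y = 0"
  and w22_bracket_zero_right: "w22_bracket x 0 = 0"
  using w22_bracket_scale_left[of "-1" x y] w22_bracket_scale_right[of x "-1" y]
    w22_bracket_scale_left[of 0 x y] w22_bracket_scale_right[of x 0 y]
  by simp_all

lemma w22_cocycle_swap: "w22_cocycle n m = - w22_cocycle m n"
proof (cases "m + n = 0")
  case True
  then have n: "n = - m" by simp
  show ?thesis unfolding n w22_cocycle_def by (simp add: field_simps)
next
  case False
  then show ?thesis by (simp add: w22_cocycle_def add.commute)
qed

lemma w22_basis_bracket_W_L:
  "w22_basis_bracket (W m) (L n) =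
     w22_scale (of_int (n - m)) (w22_elem (W (m + n))) + w22_scale (w22_cocycle m n) (w22_elem C2)"
  by (rule poly_mapping_eqI) (simp add: lookup_add lookup_minus algebra_simps w22_cocycle_swap[of n m])

lemma w22_basis_bracket_antisym: "w22_basis_bracket a b + w22_basis_bracket b a = 0"
proof (rule poly_mapping_eqI)
  fix d
  show "Poly_Mapping.lookup (w22_basis_bracket a b + w22_basis_bracket b a) d = Poly_Mapping.lookup 0 d"
  proof (cases a; cases b)
    fix m n
    assume "a = L m" "b = L n"
    then show ?thesis
      using w22_cocycle_swap[of m n] by (cases d) (simp_all add: lookup_add lookup_single when_def add.commute)
  next
    fix m n
    assume "a = L m" "b = W n"
    then show ?thesis
      by (simp add: lookup_add lookup_minus add.commute)
  next
    fix m n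
    assume "a = W m" "b = L n"
    then show ?thesis
      by (simp add: lookup_add lookup_minus add.commute)
  qed simp_all
qed

lemma w22_bracket_antisym: "w22_bracket x y + w22_bracket y x = 0"
proof (rule w22_linear_zero[where F = "\<lambda>x. w22_bracket x y + w22_bracket y x"])
  fix a
  show "w22_bracket (w22_elem a) y + w22_bracket y (w22_elem a) = 0"
    by (rule w22_linear_zero[where F = "\<lambda>y. w22_bracket (w22_elem a) y + w22_bracket y (w22_elem a)"])
      (simp_all add: w22_bracket_linear w22_bracket_basis w22_basis_bracket_antisym
        w22.scale_right_distrib)
qed (simp_all add: w22_bracket_linear w22.scale_right_distrib)

lemma w22_cocycle_jacobi:
  "of_int (p - n) * w22_cocycle m (n + p) + of_int (m - p) * w22_cocycle n (p + m)
     + of_int (n - m) * w22_cocycle p (m + n) = 0"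
proof (cases "m + n + p = 0")
  case True
  then have p: "p = - m - n" by simp
  show ?thesis
    unfolding w22_cocycle_def p by (simp add: field_simps power3_eq_cube)
next
  case False
  then show ?thesis by (simp add: w22_cocycle_def algebra_simps)
qed

lemma w22_basis_jacobi:
  "w22_bracket (w22_elem a) (w22_basis_bracket b c) + w22_bracket (w22_elem b) (w22_basis_bracket c a)
     + w22_bracket (w22_elem c) (w22_basis_bracket a b) = 0"
proof -
  note bracket = w22_bracket_linear w22_bracket_basis w22_bracket_zero_right w22_basis_bracket_W_L
  note cocycle = w22_cocycle_jacobi[simplified]
  show ?thesis
    by (cases a; cases b; cases c; simp add: bracket del: w22_basis_bracket.simps(3);
        rule poly_mapping_eqI; rename_tac d; case_tac d;
        simp add: lookup_add lookup_single when_def cocycle; simp add: algebra_simps)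
qed

lemma w22_jacobi:
  "w22_bracket x (w22_bracket y z) + w22_bracket y (w22_bracket z x) + w22_bracket z (w22_bracket x y) = 0"
proof (rule w22_linear_zero[where F = "\<lambda>x. w22_bracket x (w22_bracket y z)
    + w22_bracket y (w22_bracket z x) + w22_bracket z (w22_bracket x y)"])
  fix a :: w22_basis
  let ?a = "w22_elem a"
  show "w22_bracket ?a (w22_bracket y z) + w22_bracket y (w22_bracket z ?a)
      + w22_bracket z (w22_bracket ?a y) = 0"
  proof (rule w22_linear_zero[where F = "\<lambda>y. w22_bracket ?a (w22_bracket y z)
      + w22_bracket y (w22_bracket z ?a) + w22_bracket z (w22_bracket ?a y)"])
    fix b :: w22_basis
    let ?b = "w22_elem b"
    show "w22_bracket ?a (w22_bracket ?b z) + w22_bracket ?b (w22_bracket z ?a)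
        + w22_bracket z (w22_bracket ?a ?b) = 0"
      by (rule w22_linear_zero[where F = "\<lambda>z. w22_bracket ?a (w22_bracket ?b z)
          + w22_bracket ?b (w22_bracket z ?a) + w22_bracket z (w22_bracket ?a ?b)"])
        (simp_all add: w22_bracket_linear w22_bracket_basis w22_basis_jacobi
          w22.scale_right_distrib)
  qed (simp_all add: w22_bracket_linear w22.scale_right_distrib)
qed (simp_all add: w22_bracket_linear w22.scale_right_distrib)

interpretation w22: lie_algebra w22_scale w22_bracket
proof
  fix x
  have "w22_scale 2 (w22_bracket x x) = 0"
    using w22_bracket_antisym[of x x] w22.scale_left_distrib[of 1 1 "w22_bracket x x"] by simp
  then show "w22_bracket x x = 0"
    by simp
qed (simp_all add: w22_bracket_linear w22_jacobi)

definition w22_cartan :: "w22 set" where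
  "w22_cartan = w22.span {w22_elem (L 0), w22_elem (W 0)}"

lemma w22_cartan_subalgebra: "w22.lie_subalgebra w22_cartan"
proof -
  have rep: "\<exists>a b. x = w22_scale a (w22_elem (L 0)) + w22_scale b (w22_elem (W 0))"
    if "x \<in> w22_cartan" for x
    using that by (auto simp: w22_cartan_def w22.span_insert w22.span_singleton algebra_simps)
  have "w22_bracket x y = 0" if xy: "x \<in> w22_cartan" "y \<in> w22_cartan" for x y
  proof -
    obtain a b c d where "x = w22_scale a (w22_elem (L 0)) + w22_scale b (w22_elem (W 0))"
      and "y = w22_scale c (w22_elem (L 0)) + w22_scale d (w22_elem (W 0))"
      using rep[OF xy(1)] rep[OF xy(2)] by blast
    then show ?thesis
      by (simp add: w22_bracket_linear w22_bracket_basis w22_cocycle_def)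
  qed
  then show ?thesis
    by (simp add: w22.lie_subalgebra_def w22_cartan_def w22.subspace_span w22.span_zero)
qed


section \<open>The families \<open>\<H>\<^sub>\<alpha>\<close>\<close>

definition h_poly :: "complex \<Rightarrow> int \<Rightarrow> nat \<Rightarrow> complex poly" where
  "h_poly \<alpha> n k =
     smult (of_int n) (monom 1 k)
     - smult (of_int (n * (n - 1)) * \<alpha>) (\<Sum>j<k. monom (\<alpha> ^ (k - 1 - j)) j)"

lemma h_poly_quotient:
  "(\<Sum>j<k. monom (\<alpha> ^ (k - 1 - j)) j) = (monom 1 k - [:\<alpha> ^ k:]) div [:- \<alpha>, 1:]"
  for \<alpha> :: complex
proof -
  have "monom 1 1 ^ k - [:\<alpha>:] ^ k
      = (monom 1 1 - [:\<alpha>:]) * (\<Sum>j<k. [:\<alpha>:] ^ (k - Suc j) * monom 1 1 ^ j)"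
    by (rule power_diff_sumr2)
  moreover have "[:\<alpha>:] ^ i * monom 1 1 ^ j = monom (\<alpha> ^ i) j" for i j
    by (simp add: monom_power poly_const_pow smult_monom)
  moreover have "monom 1 1 - [:\<alpha>:] = [:- \<alpha>, 1:]"
    by (simp add: monom_altdef)
  ultimately have "monom 1 k - [:\<alpha> ^ k:] = [:- \<alpha>, 1:] * (\<Sum>j<k. monom (\<alpha> ^ (k - 1 - j)) j)"
    by (simp add: monom_power poly_const_pow)
  then show ?thesis
    by (simp only: nonzero_mult_div_cancel_left[of "[:- \<alpha>, 1:]"] pCons_eq_0_iff one_neq_zero
        simp_thms)
qed

definition H_families :: "complex \<Rightarrow> (int \<Rightarrow> complex poly) set" where
  "H_families \<alpha> =
     {h. \<exists>\<xi> :: nat \<Rightarrow> complex. finite {i. \<xi> i \<noteq> 0} \<and>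
        (\<forall>n. h n = (\<Sum>i | \<xi> i \<noteq> 0. smult (\<xi> i) (h_poly \<alpha> n i)))}"


section \<open>The module \<open>\<Omega>(\<lambda>,\<alpha>,h)\<close>\<close>

text \<open>\<open>\<complex>[t,s]\<close> is represented as \<open>\<complex>[t][s]\<close>: the outer variable is \<open>s\<close>, the coefficients are
  polynomials in \<open>t\<close>.\<close>

type_synonym poly_ts = "complex poly poly"

definition ts_scale :: "complex \<Rightarrow> poly_ts \<Rightarrow> poly_ts" where
  "ts_scale c f = smult [:c:] f"

abbreviation (input) var_s :: poly_ts where "var_s \<equiv> [:0, 1:]"
abbreviation (input) var_t :: poly_ts where "var_t \<equiv> [:[:0, 1:]:]"
abbreviation (input) const_ts :: "complex \<Rightarrow> poly_ts" where "const_ts c \<equiv> [:[:c:]:]"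
abbreviation (input) poly_in_t :: "complex poly \<Rightarrow> poly_ts" where "poly_in_t p \<equiv> [:p:]"

definition shift_s :: "int \<Rightarrow> poly_ts \<Rightarrow> poly_ts" where
  "shift_s m f = pcompose f (var_s - const_ts (of_int m))"

definition deriv_t :: "poly_ts \<Rightarrow> poly_ts" where
  "deriv_t f = map_poly pderiv f"

definition Omega_W :: "complex \<Rightarrow> complex \<Rightarrow> int \<Rightarrow> poly_ts \<Rightarrow> poly_ts" where
  "Omega_W lam \<alpha> m f =
     ts_scale (lam powi m) ((var_t - const_ts (of_int m * \<alpha>)) * shift_s m f)"

definition Omega_L ::
  "complex \<Rightarrow> complex \<Rightarrow> (int \<Rightarrow> complex poly) \<Rightarrow> int \<Rightarrow> poly_ts \<Rightarrow> poly_ts" where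
  "Omega_L lam \<alpha> h m f =
     ts_scale (lam powi m) ((var_s + poly_in_t (h m)) * shift_s m f)
     - ts_scale (of_int m * lam powi m)
         ((var_t - const_ts (of_int m * \<alpha>)) * deriv_t (shift_s m f))"

fun Omega_basis_act ::
  "complex \<Rightarrow> complex \<Rightarrow> (int \<Rightarrow> complex poly) \<Rightarrow> w22_basis \<Rightarrow> poly_ts \<Rightarrow> poly_ts" where
  "Omega_basis_act lam \<alpha> h (L m) f = Omega_L lam \<alpha> h m f"
| "Omega_basis_act lam \<alpha> h (W m) f = Omega_W lam \<alpha> m f"
| "Omega_basis_act lam \<alpha> h C1 f = 0"
| "Omega_basis_act lam \<alpha> h C2 f = 0"

definition Omega_act ::
  "complex \<Rightarrow> complex \<Rightarrow> (int \<Rightarrow> complex poly) \<Rightarrow> w22 \<Rightarrow> poly_ts \<Rightarrow> poly_ts" where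
  "Omega_act lam \<alpha> h x f = linear_extension ts_scale (\<lambda>a. Omega_basis_act lam \<alpha> h a f) x"

end

theory Submission
  imports Defs
begin

text \<open>After cancelling the scalars \<open>\<lambda>\<^sup>m\<close>, the operators are \<open>W\<^sub>m = (t - m\<alpha>) \<sigma>\<^sup>m\<close> and
  \<open>L\<^sub>m = (s + h\<^sub>m - m(t - m\<alpha>)\<partial>\<^sub>t) \<sigma>\<^sup>m\<close> with \<open>\<sigma> f(t, s) = f(t, s - 1)\<close>. The bracket relations reduce to one
  identity between \<open>h\<^sub>m\<close>, \<open>h\<^sub>n\<close>, \<open>h\<^bsub>m+n\<^esub>\<close> and their derivatives, which is linear in \<open>h\<close> and holds for each
  \<open>h\<^bsub>n,k;\<alpha>\<^esub>\<close>. As \<open>h\<^sub>0 = 0\<close>, \<open>L\<^sub>0\<close> and \<open>W\<^sub>0\<close> act as multiplication by \<open>s\<close> and \<open>t\<close>; modulo the defining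
  relations every word in the abelian algebra \<open>\<complex>L\<^sub>0 \<oplus> \<complex>W\<^sub>0\<close> equals the ordered polynomial by which it acts
  on \<open>1\<close>, so \<open>{1}\<close> is a basis.

  A submodule is thus an ideal of \<open>\<complex>[t, s]\<close>. For \<open>\<alpha> = 0\<close> the ideal \<open>(t)\<close> is a proper submodule. For
  \<open>\<alpha> \<noteq> 0\<close> a nonzero submodule contains \<open>(t - \<alpha>)(\<sigma> f - f)\<close> along with \<open>f\<close>, hence a nonzero \<open>p(t)\<close>;
  it then contains \<open>(t - \<alpha>)p'\<close> and \<open>(t - 2\<alpha>)p'\<close>, hence \<open>p'\<close>, and eventually a nonzero constant.\<close>

section \<open>Modules over the enveloping algebra\<close>

lemma single_Cons:
  "Poly_Mapping.single (x # w) c = Poly_Mapping.single [x] 1 * Poly_Mapping.single w (c :: 'k::semiring_1)"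
  by (simp add: mult_single plus_list_def)

lemma poly_mapping_sum_single:
  "p = (\<Sum>w\<in>Poly_Mapping.keys p. Poly_Mapping.single w (Poly_Mapping.lookup p w))"
  by (rule poly_mapping_eqI) (simp add: lookup_sum lookup_single when_def in_keys_iff)

lemma free_algebra_simps [simp]:
  "mult (free_algebra H) = (*)" "one (free_algebra H) = 1"
  "zero (free_algebra H) = 0" "add (free_algebra H) = (+)"
  by (simp_all add: free_algebra_def)

lemma carrier_free_algebra_iff:
  "p \<in> carrier (free_algebra H) \<longleftrightarrow> Poly_Mapping.keys p \<subseteq> lists H"
  by (simp add: free_algebra_def)

lemma free_algebra_mult_closed:
  assumes "p \<in> carrier (free_algebra H)" "q \<in> carrier (free_algebra H)"
  shows "p * q \<in> carrier (free_algebra H)"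
  unfolding carrier_free_algebra_iff
proof
  fix w
  assume "w \<in> Poly_Mapping.keys (p * q)"
  then obtain u v where "w = u @ v" "u \<in> Poly_Mapping.keys p" "v \<in> Poly_Mapping.keys q"
    using keys_mult[of p q] by (auto simp: plus_list_def)
  with assms show "w \<in> lists H"
    by (auto simp: carrier_free_algebra_iff)
qed

lemma ring_free_algebra: "ring (free_algebra H :: ('a list \<Rightarrow>\<^sub>0 'b::field) ring)"
  (is "ring ?F")
proof (rule ringI)
  show "abelian_group ?F"
  proof (rule abelian_groupI)
    fix p :: "'a list \<Rightarrow>\<^sub>0 'b"
    assume "p \<in> carrier (free_algebra H)"
    then show "\<exists>q\<in>carrier ?F. q \<oplus>\<^bsub>?F\<^esub> p = \<zero>\<^bsub>?F\<^esub>"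
      by (intro bexI[of _ "- p"]) (simp_all add: carrier_free_algebra_iff)
  next
    fix p q :: "'a list \<Rightarrow>\<^sub>0 'b"
    assume "p \<in> carrier (free_algebra H)" "q \<in> carrier (free_algebra H)"
    then show "p \<oplus>\<^bsub>?F\<^esub> q \<in> carrier ?F"
      using keys_add[of p q] by (auto simp: carrier_free_algebra_iff)
  qed (simp_all add: carrier_free_algebra_iff add_ac)
  have "(1 :: 'a list \<Rightarrow>\<^sub>0 'b) = Poly_Mapping.single [] 1"
    by (simp only: zero_list_def[symmetric] single_one)
  then have one: "(1 :: 'a list \<Rightarrow>\<^sub>0 'b) \<in> carrier (free_algebra H)"
    by (simp add: carrier_free_algebra_iff zero_list_def)
  show "Group.monoid ?F"
    by (rule monoidI) (simp_all add: free_algebra_mult_closed mult.assoc one)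
qed (simp_all add: distrib_left distrib_right)

lemma single_in_free_algebra:
  "w \<in> lists H \<Longrightarrow> Poly_Mapping.single w c \<in> carrier (free_algebra H)"
  by (simp add: carrier_free_algebra_iff)

lemma free_algebra_diff_closed:
  assumes "p \<in> carrier (free_algebra H)" "q \<in> carrier (free_algebra H)"
  shows "p - q \<in> carrier (free_algebra H)"
  using assms keys_diff[of p q] by (auto simp: carrier_free_algebra_iff)

text \<open>Closure of H under linear combinations and brackets makes \<open>sg a x + sg b y\<close>
  and \<open>br x y\<close> letters of H, so the ideal is generated by elements of the
  carrier.\<close>

lemma (in lie_algebra) enveloping_relations_closed:
  assumes "lie_subalgebra H"
  shows "enveloping_relations H \<subseteq> carrier (free_algebra H)"
proof -
  have "sg a x + sg b y \<in> H" "br x y \<in> H" if "x \<in> H" "y \<in> H" for a b x y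
    using assms that by (auto simp: lie_subalgebra_def g.subspace_add g.subspace_scale)
  then show ?thesis
    by (auto simp: enveloping_relations_def intro!: free_algebra_diff_closed single_in_free_algebra)
qed

lemma a_r_coset_free_algebra: "I +>\<^bsub>free_algebra H\<^esub> p = {i + p | i. i \<in> I}"
  by (auto simp: a_r_coset_def')

section \<open>Descent of the action from words to residue classes\<close>

context lie_module
begin

lemma foldr_act_add: "foldr \<rho> w (u + v) = foldr \<rho> w u + foldr \<rho> w v"
  by (induction w) (simp_all add: act_add_right)

lemma foldr_act_scale: "foldr \<rho> w (sm c v) = sm c (foldr \<rho> w v)"
  by (induction w) (simp_all add: act_scale_right)

lemma free_algebra_act_single [simp]:
  "free_algebra_act (Poly_Mapping.single w c) v = sm c (foldr \<rho> w v)"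
  by (simp add: free_algebra_act_def)

lemma free_algebra_act_add:
  "free_algebra_act (p + q) v = free_algebra_act p v + free_algebra_act q v"
  by (simp add: free_algebra_act_def M.linear_extension_add)

lemma free_algebra_act_zero [simp]: "free_algebra_act 0 v = 0"
  using free_algebra_act_add[of 0 0 v] by simp

lemma free_algebra_act_diff:
  "free_algebra_act (p - q) v = free_algebra_act p v - free_algebra_act q v"
  using free_algebra_act_add[of "p - q" q v] by (simp add: algebra_simps)

lemma free_algebra_act_sum:
  "free_algebra_act (sum f A) v = (\<Sum>a\<in>A. free_algebra_act (f a) v)"
  by (induction A rule: infinite_finite_induct) (simp_all add: free_algebra_act_add)

lemma free_algebra_act_add_right:
  "free_algebra_act p (u + v) = free_algebra_act p u + free_algebra_act p v"
  by (simp add: free_algebra_act_def foldr_act_add M.linear_extension_add_fun)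

lemma free_algebra_act_zero_right [simp]: "free_algebra_act p 0 = 0"
  using free_algebra_act_add_right[of p 0 0] by simp

lemma free_algebra_act_one [simp]: "free_algebra_act 1 v = v"
  using free_algebra_act_single[of 0 1 v] by (simp only: single_one) (simp add: zero_list_def)

text \<open>Concatenating words composes their operators; additivity extends this from single words
  to sums, first in q and then in p.\<close>

lemma free_algebra_act_mult: "free_algebra_act (p * q) v = free_algebra_act p (free_algebra_act q v)"
proof -
  have single: "free_algebra_act (Poly_Mapping.single w c * q) v
      = sm c (foldr \<rho> w (free_algebra_act q v))" for w c
  proof -
    have sum: "foldr \<rho> w (sum f A) = (\<Sum>a\<in>A. foldr \<rho> w (f a))" for f :: "'g list \<Rightarrow> 'm" and A
      \<comment> \<open>The scalar 0 instance says that every word sends 0 to 0, which is the base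
        case.\<close>
      using foldr_act_scale[of w 0 0]
      by (induction A rule: infinite_finite_induct) (simp_all add: foldr_act_add)
    show ?thesis
      by (subst (1 2) poly_mapping_sum_single[of q])
        (simp add: sum_distrib_left mult_single plus_list_def free_algebra_act_sum foldr_act_scale sum
          M.scale_sum_right)
  qed
  show ?thesis
    by (subst (1 2) poly_mapping_sum_single[of p])
      (simp add: sum_distrib_right free_algebra_act_sum single)
qed

text \<open>The elements annihilating the whole module form a two-sided ideal. It contains the
  linearity and the commutator relations, hence the ideal they generate.\<close>

lemma enveloping_ideal_act_zero:
  assumes "lie_subalgebra H" "p \<in> Idl\<^bsub>free_algebra H\<^esub> (enveloping_relations H)"
  shows "free_algebra_act p v = 0"
proof -
  interpret F: ring "free_algebra H :: ('g list \<Rightarrow>\<^sub>0 'k) ring" by (rule ring_free_algebra)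
  \<comment> \<open>Quantifying over all vectors gives closure under right multiplication, since
    \<open>p * q\<close> applies p to the image of v under q.\<close>
  let ?K = "{p \<in> carrier (free_algebra H). \<forall>v. free_algebra_act p v = 0}"
  have "ideal ?K (free_algebra H)"
  proof (rule idealI[OF ring_free_algebra])
    show "subgroup ?K (add_monoid (free_algebra H))"
    proof (rule F.add.subgroupI)
      fix p assume p: "p \<in> ?K"
      then have "- p \<in> carrier (free_algebra H)" "- p + p = 0"
        by (simp_all add: carrier_free_algebra_iff)
      then have "\<ominus>\<^bsub>free_algebra H\<^esub> p = - p"
        using p by (intro F.minus_equality) simp_all
      then show "\<ominus>\<^bsub>free_algebra H\<^esub> p \<in> ?K"
        using p free_algebra_act_diff[of 0 p] \<open>- p \<in> _\<close> by simp
    qed (use F.zero_closed F.add.m_closed in \<open>auto simp: free_algebra_act_add\<close>)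
  qed (auto simp: free_algebra_mult_closed free_algebra_act_mult)
  moreover have "free_algebra_act r v = 0" if "r \<in> enveloping_relations H" for r v
    using that
    by (auto simp: enveloping_relations_def free_algebra_act_diff act_add_left act_scale_left
        act_bracket)
  then have "enveloping_relations H \<subseteq> ?K"
    using enveloping_relations_closed[OF assms(1)] by blast
  ultimately show ?thesis
    using F.genideal_minimal assms(2) by blast
qed

text \<open>Two representatives differ by an element of the ideal, which acts as zero; so the
  definite description in \<open>enveloping_act\<close> has a unique value.\<close>

lemma enveloping_act_coset:
  assumes "lie_subalgebra H" "p \<in> carrier (free_algebra H)"
  shows "enveloping_act (Idl\<^bsub>free_algebra H\<^esub> (enveloping_relations H) +>\<^bsub>free_algebra H\<^esub> p) v
    = free_algebra_act p v"
proof -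
  let ?I = "Idl\<^bsub>free_algebra H\<^esub> (enveloping_relations H) :: ('g list \<Rightarrow>\<^sub>0 'k) set"
  interpret F: ring "free_algebra H :: ('g list \<Rightarrow>\<^sub>0 'k) ring" by (rule ring_free_algebra)
  interpret I: ideal ?I "free_algebra H"
    by (rule F.genideal_ideal) (rule enveloping_relations_closed[OF assms(1)])
  have "p \<in> ?I +>\<^bsub>free_algebra H\<^esub> p"
    by (rule I.a_rcos_self) (rule assms)
  moreover have "free_algebra_act q v = free_algebra_act p v"
    if "q \<in> ?I +>\<^bsub>free_algebra H\<^esub> p" for q
    using that enveloping_ideal_act_zero[OF assms(1)]
    by (auto simp: a_r_coset_free_algebra free_algebra_act_add)
  ultimately show ?thesis
    unfolding enveloping_act_def by - (rule the_equality, blast, metis)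
qed

lemma enveloping_algebra_coset:
  assumes "X \<in> carrier (enveloping_algebra H)"
  obtains p where "p \<in> carrier (free_algebra H)"
    "X = Idl\<^bsub>free_algebra H\<^esub> (enveloping_relations H) +>\<^bsub>free_algebra H\<^esub> p"
  using assms by (auto simp: enveloping_algebra_def FactRing_def A_RCOSETS_def' a_r_coset_def')

lemma left_module_enveloping:
  assumes "lie_subalgebra H"
  shows "left_module (enveloping_algebra H) enveloping_act"
proof -
  let ?I = "Idl\<^bsub>free_algebra H\<^esub> (enveloping_relations H) :: ('g list \<Rightarrow>\<^sub>0 'k) set"
  interpret F: ring "free_algebra H :: ('g list \<Rightarrow>\<^sub>0 'k) ring" by (rule ring_free_algebra)
  interpret I: ideal ?I "free_algebra H"
    by (rule F.genideal_ideal) (rule enveloping_relations_closed[OF assms])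
  have add: "(?I +>\<^bsub>free_algebra H\<^esub> p) \<oplus>\<^bsub>enveloping_algebra H\<^esub> (?I +>\<^bsub>free_algebra H\<^esub> q)
      = ?I +>\<^bsub>free_algebra H\<^esub> (p + q)"
    and mult: "(?I +>\<^bsub>free_algebra H\<^esub> p) \<otimes>\<^bsub>enveloping_algebra H\<^esub> (?I +>\<^bsub>free_algebra H\<^esub> q)
      = ?I +>\<^bsub>free_algebra H\<^esub> (p * q)"
    if "p \<in> carrier (free_algebra H)" "q \<in> carrier (free_algebra H)" for p q
    using that I.a_rcos_sum[of p q] I.rcoset_mult_add[of p q]
    by (simp_all add: enveloping_algebra_def FactRing_def)
  show ?thesis
  proof (intro left_module.intro left_module_axioms.intro)
    show "ring (enveloping_algebra H)"
      unfolding enveloping_algebra_def by (rule I.quotient_is_ring)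
    show "enveloping_act \<one>\<^bsub>enveloping_algebra H\<^esub> v = v" for v
      using enveloping_act_coset[OF assms, of 1 v] F.one_closed
      by (simp add: enveloping_algebra_def FactRing_def)
  next
    fix X Y v
    assume XY: "X \<in> carrier (enveloping_algebra H)" "Y \<in> carrier (enveloping_algebra H)"
    obtain p q where pq: "p \<in> carrier (free_algebra H)" "q \<in> carrier (free_algebra H)"
      "X = ?I +>\<^bsub>free_algebra H\<^esub> p" "Y = ?I +>\<^bsub>free_algebra H\<^esub> q"
      using XY enveloping_algebra_coset by metis
    then have "p + q \<in> carrier (free_algebra H)" "p * q \<in> carrier (free_algebra H)"
      using F.add.m_closed[of p q] by (simp_all add: free_algebra_mult_closed)
    with pq show "enveloping_act (X \<oplus>\<^bsub>enveloping_algebra H\<^esub> Y) v = enveloping_act X v + enveloping_act Y v"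
      "enveloping_act (X \<otimes>\<^bsub>enveloping_algebra H\<^esub> Y) v = enveloping_act X (enveloping_act Y v)"
      by (simp_all add: add mult enveloping_act_coset[OF assms]
          free_algebra_act_add free_algebra_act_mult)
  next
    fix X u v
    assume X: "X \<in> carrier (enveloping_algebra H)"
    then show "enveloping_act X (u + v) = enveloping_act X u + enveloping_act X v"
      by (auto elim!: enveloping_algebra_coset
          simp: enveloping_act_coset[OF assms] free_algebra_act_add_right)
  qed
qed

end

section \<open>The commutation relations of \<open>\<Omega>(\<lambda>,\<alpha>,h)\<close>\<close>

text \<open>This is the part of [L_m, L_n] = (n - m) L_{m+n} that multiplies by a polynomial in t.
  With e = t^k and q = (t^k - \<alpha>^k)/(t - \<alpha>), everything is expressed in t, \<alpha>, e,
  q and q', where the equation is a ring identity.\<close>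

lemma h_poly_recursion:
  fixes \<alpha> :: complex and m n :: int and k :: nat
  defines "t \<equiv> [:0, 1:] :: complex poly" and "a \<equiv> [:\<alpha>:]"
  shows "of_int n * h_poly \<alpha> n k - of_int m * h_poly \<alpha> m k
     - of_int m * (t - of_int m * a) * pderiv (h_poly \<alpha> n k)
     + of_int n * (t - of_int n * a) * pderiv (h_poly \<alpha> m k)
     = of_int (n - m) * h_poly \<alpha> (m + n) k"
proof -
  define q where "q = (\<Sum>j<k. monom (\<alpha> ^ (k - 1 - j)) j)"
  define e where "e = (monom 1 k :: complex poly)"
  have h: "h_poly \<alpha> i k = of_int i * e - of_int i * (of_int i - 1) * a * q" for i
    by (simp add: h_poly_def q_def e_def a_def of_int_poly one_pCons mult_ac)
  have "t ^ k - a ^ k = (t - a) * (\<Sum>j<k. a ^ (k - Suc j) * t ^ j)"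
    by (rule power_diff_sumr2)
  moreover have "a ^ i * t ^ j = monom (\<alpha> ^ i) j" for i j
    by (simp add: a_def t_def poly_const_pow monom_altdef)
  ultimately have "e - [:\<alpha> ^ k:] = (t - a) * q"
    by (simp add: e_def q_def a_def t_def poly_const_pow monom_altdef)
  \<comment> \<open>Differentiating e - \<alpha>^k = (t - \<alpha>) q drops the constant and trades
    e' for q and q'.\<close>
  from arg_cong[OF this, of pderiv] have de: "pderiv e = q + (t - a) * pderiv q"
    by (simp add: pderiv_diff pderiv_mult pderiv_smult t_def a_def pderiv_pCons)
  have dh: "pderiv (h_poly \<alpha> i k) = of_int i * (q + (t - a) * pderiv q)
      - of_int i * (of_int i - 1) * a * pderiv q" for i
    unfolding h de[symmetric] by (simp add: pderiv_diff pderiv_mult pderiv_smult a_def of_int_poly one_pCons)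
  show ?thesis
    unfolding dh unfolding h by (simp add: algebra_simps)
qed

lemma H_families_zero:
  assumes "h \<in> H_families \<alpha>"
  shows "h 0 = 0"
  using assms by (auto simp: H_families_def h_poly_def)

text \<open>The identity is linear in the family, and the same coefficients \<xi>_i serve for n, m
  and m + n, so it can be checked term by term.\<close>

lemma H_families_recursion:
  fixes h :: "int \<Rightarrow> complex poly" and \<alpha> :: complex and m n :: int
  defines "t \<equiv> [:0, 1:] :: complex poly" and "a \<equiv> [:\<alpha>:]"
  assumes "h \<in> H_families \<alpha>"
  shows "of_int n * h n - of_int m * h m - of_int m * (t - of_int m * a) * pderiv (h n)
     + of_int n * (t - of_int n * a) * pderiv (h m) = of_int (n - m) * h (m + n)"
proof -
  obtain \<xi> where fin: "finite {i. \<xi> i \<noteq> 0}"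
    and h: "\<And>n. h n = (\<Sum>i | \<xi> i \<noteq> 0. smult (\<xi> i) (h_poly \<alpha> n i))"
    using assms(3) by (auto simp: H_families_def)
  have pderiv_sum: "pderiv (sum f A) = (\<Sum>i\<in>A. pderiv (f i))" for f :: "nat \<Rightarrow> complex poly" and A
    by (induction A rule: infinite_finite_induct) (simp_all add: pderiv_add)
  have dh: "pderiv (h n) = (\<Sum>i | \<xi> i \<noteq> 0. smult (\<xi> i) (pderiv (h_poly \<alpha> n i)))" for n
    by (simp add: h pderiv_sum pderiv_smult)
  show ?thesis
    unfolding dh unfolding h sum_distrib_left sum.distrib[symmetric] sum_subtractf[symmetric]
  proof (rule sum.cong[OF refl])
    fix i
    show "of_int n * smult (\<xi> i) (h_poly \<alpha> n i) - of_int m * smult (\<xi> i) (h_poly \<alpha> m i)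
        - of_int m * (t - of_int m * a) * smult (\<xi> i) (pderiv (h_poly \<alpha> n i))
        + of_int n * (t - of_int n * a) * smult (\<xi> i) (pderiv (h_poly \<alpha> m i))
      = of_int (n - m) * smult (\<xi> i) (h_poly \<alpha> (m + n) i)"
      using arg_cong[OF h_poly_recursion[of n \<alpha> i m], of "smult (\<xi> i)"]
      unfolding t_def a_def by (simp only: smult_add_right smult_diff_right mult_smult_right)
  qed
qed

section \<open>Calculus of the s-shift and the t-derivative\<close>

abbreviation const_poly_ts :: "complex \<Rightarrow> poly_ts" where
  "const_poly_ts c \<equiv> [:[:c:]:]"

lemma ts_scale_eq_mult: "ts_scale c f = const_poly_ts c * f"
  by (simp add: ts_scale_def)

lemma vector_space_ts: "vector_space ts_scale"
  by standard (simp_all add: ts_scale_def smult_add_right mult.commute flip: smult_add_left one_pCons)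

interpretation ts: vector_space ts_scale
  by (rule vector_space_ts)

lemma shift_s_0 [simp]: "shift_s 0 f = f"
  by (simp add: shift_s_def)

lemma shift_s_zero [simp]: "shift_s m 0 = 0"
  by (simp add: shift_s_def)

lemma shift_s_pCons: "shift_s m (pCons c f) = [:c:] + (var_s - of_int m) * shift_s m f"
  by (simp add: shift_s_def pcompose_pCons of_int_poly)

lemma shift_s_const [simp]: "shift_s m [:c:] = [:c:]"
  by (simp add: shift_s_def)

lemma shift_s_add: "shift_s m (f + g) = shift_s m f + shift_s m g"
  by (simp add: shift_s_def pcompose_add)

lemma shift_s_diff: "shift_s m (f - g) = shift_s m f - shift_s m g"
  by (simp add: shift_s_def pcompose_diff)

lemma shift_s_mult: "shift_s m (f * g) = shift_s m f * shift_s m g"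
  by (simp add: shift_s_def pcompose_mult)

lemma shift_s_of_int [simp]: "shift_s m (of_int k) = of_int k"
  by (simp add: of_int_poly)

lemma shift_s_var_s: "shift_s m var_s = var_s - of_int m"
  by (simp add: shift_s_pCons)

lemma shift_s_shift_s: "shift_s m (shift_s n f) = shift_s (m + n) f"
  by (induction f)
    (simp_all add: shift_s_pCons shift_s_add shift_s_mult shift_s_diff shift_s_var_s algebra_simps)

lemma deriv_t_pCons: "deriv_t (pCons c f) = pCons (pderiv c) (deriv_t f)"
  by (cases "f = 0 \<and> c = 0") (auto simp: deriv_t_def map_poly_pCons)

lemma deriv_t_0 [simp]: "deriv_t 0 = 0"
  by (simp add: deriv_t_def)

lemma deriv_t_add: "deriv_t (f + g) = deriv_t f + deriv_t g"
  by (induction f g rule: poly_induct2) (simp_all add: deriv_t_pCons pderiv_add)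

lemma deriv_t_diff: "deriv_t (f - g) = deriv_t f - deriv_t g"
  using deriv_t_add[of "f - g" g] by simp

lemma deriv_t_mult: "deriv_t (f * g) = f * deriv_t g + deriv_t f * g"
proof -
  \<comment> \<open>The case of a factor in C[t] is the product rule of \<open>pderiv\<close>
    applied to each coefficient.\<close>
  have "deriv_t (smult c g) = smult c (deriv_t g) + smult (pderiv c) g" for c
    by (induction g) (simp_all add: deriv_t_pCons pderiv_mult mult.commute)
  then show ?thesis
    by (induction f) (simp_all add: deriv_t_pCons deriv_t_add)
qed

lemma deriv_t_of_int [simp]: "deriv_t (of_int k) = 0"
  by (simp add: of_int_poly deriv_t_pCons)

text \<open>The substituted polynomial s - m is free of t, so its t-derivative vanishes.\<close>

lemma deriv_t_shift_s: "deriv_t (shift_s m f) = shift_s m (deriv_t f)"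
proof (induction f)
  case 0
  then show ?case by (simp add: shift_s_def)
next
  case (pCons c f)
  have "deriv_t var_s = 0" by (simp add: deriv_t_pCons one_pCons)
  with pCons show ?case
    by (simp add: shift_s_pCons deriv_t_pCons deriv_t_add deriv_t_mult deriv_t_diff)
qed

section \<open>The operators and their commutators\<close>

lemma Omega_W_eq:
  "Omega_W lam \<alpha> m f =
     const_poly_ts (lam powi m) * ((var_t - of_int m * const_poly_ts \<alpha>) * shift_s m f)"
  by (simp add: Omega_W_def ts_scale_eq_mult of_int_poly)

text \<open>Scalars become factors and the derivative moves inside the shift, which turns
  commutators into identities of one commutative ring.\<close>

lemma Omega_L_eq:
  "Omega_L lam \<alpha> h m f =
     const_poly_ts (lam powi m) * ((var_s + poly_in_t (h m)) * shift_s m f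
       - of_int m * (var_t - of_int m * const_poly_ts \<alpha>) * shift_s m (deriv_t f))"
  by (simp add: Omega_L_def ts_scale_eq_mult of_int_poly deriv_t_shift_s algebra_simps)

lemma Omega_basis_act_add:
  "Omega_basis_act lam \<alpha> h a (f + g) = Omega_basis_act lam \<alpha> h a f + Omega_basis_act lam \<alpha> h a g"
  by (cases a) (simp_all add: Omega_W_eq Omega_L_eq shift_s_add deriv_t_add distrib_left
      right_diff_distrib)

lemma Omega_basis_act_scale:
  "Omega_basis_act lam \<alpha> h a (ts_scale c f) = ts_scale c (Omega_basis_act lam \<alpha> h a f)"
  by (cases a) (simp_all only: Omega_basis_act.simps Omega_W_eq Omega_L_eq ts_scale_eq_mult
      shift_s_mult deriv_t_mult shift_s_const deriv_t_pCons pderiv_singleton deriv_t_0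
      pCons_0_0 mult_zero_left mult_zero_right add_0_left add_0_right right_diff_distrib mult_ac)

lemma powi_const_poly_ts:
  "lam \<noteq> 0 \<Longrightarrow> const_poly_ts (lam powi (m + n)) = const_poly_ts (lam powi m) * const_poly_ts (lam powi n)"
  by (simp add: power_int_add)

lemma Omega_bracket_W_W: "Omega_W lam \<alpha> m (Omega_W lam \<alpha> n f) = Omega_W lam \<alpha> n (Omega_W lam \<alpha> m f)"
proof -
  have "shift_s k var_t = var_t" for k by simp
  then show ?thesis
    unfolding Omega_W_eq shift_s_mult shift_s_diff shift_s_of_int shift_s_const shift_s_shift_s
    by (simp only: add.commute mult_ac)
qed

text \<open>Shifting s past W_n contributes n(t - n\<alpha>), differentiating t - n\<alpha>
  contributes -m(t - m\<alpha>), and all else cancels. The sum is (n - m)(t - (m +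
  n)\<alpha>).\<close>

lemma Omega_bracket_L_W:
  assumes "lam \<noteq> 0"
  shows "Omega_L lam \<alpha> h m (Omega_W lam \<alpha> n f) - Omega_W lam \<alpha> n (Omega_L lam \<alpha> h m f)
     = of_int (n - m) * Omega_W lam \<alpha> (m + n) f"
proof -
  \<comment> \<open>Opaque names keep the simplifier from computing with \<open>pCons\<close>; only
    the effect of shift and derivative on each name is used.\<close>
  define S T A H P Q
    where "S = var_s" "T = var_t" "A = const_poly_ts \<alpha>" "H = [:h m:]"
      "P = const_poly_ts (lam powi m)" "Q = const_poly_ts (lam powi n)"
  have "deriv_t S = 0" "deriv_t T = 1" "deriv_t A = 0" "deriv_t H = [:pderiv (h m):]"
    "deriv_t P = 0" "deriv_t Q = 0"
    by (simp_all add: S_T_A_H_P_Q_def deriv_t_pCons one_pCons pderiv_pCons)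
  moreover have "shift_s k S = S - of_int k" "shift_s k T = T" "shift_s k A = A" "shift_s k H = H"
    "shift_s k P = P" "shift_s k Q = Q" for k
    by (simp_all add: S_T_A_H_P_Q_def shift_s_var_s)
  ultimately show ?thesis
    unfolding Omega_W_eq Omega_L_eq powi_const_poly_ts[OF assms] S_T_A_H_P_Q_def[symmetric]
    by (simp add: shift_s_mult shift_s_diff shift_s_add shift_s_shift_s
        deriv_t_mult deriv_t_diff deriv_t_shift_s add.commute[of n m])
      (simp add: algebra_simps)
qed

text \<open>Second derivatives of f cancel by symmetry in m and n, and the first-order terms combine
  directly. The remaining coefficient of f(t, s - m - n) is (n - m)s plus the left side of
  \<open>H_families_recursion\<close>.\<close>

lemma Omega_bracket_L_L:
  assumes "lam \<noteq> 0" "h \<in> H_families \<alpha>"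
  shows "Omega_L lam \<alpha> h m (Omega_L lam \<alpha> h n f) - Omega_L lam \<alpha> h n (Omega_L lam \<alpha> h m f)
     = of_int (n - m) * Omega_L lam \<alpha> h (m + n) f"
proof -
  define S T A H G K P Q
    where "S = var_s" "T = var_t" "A = const_poly_ts \<alpha>" "H = [:h m:]" "G = [:h n:]"
      "K = [:h (m + n):]" "P = const_poly_ts (lam powi m)" "Q = const_poly_ts (lam powi n)"
  note defs = S_T_A_H_G_K_P_Q_def
  define H' G' where "H' = [:pderiv (h m):]" "G' = [:pderiv (h n):]"
  have D: "deriv_t S = 0" "deriv_t T = 1" "deriv_t A = 0" "deriv_t H = H'" "deriv_t G = G'"
    "deriv_t P = 0" "deriv_t Q = 0"
    by (simp_all add: defs H'_G'_def deriv_t_pCons one_pCons pderiv_pCons)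
  have shift: "shift_s k S = S - of_int k" "shift_s k T = T" "shift_s k A = A" "shift_s k H = H"
    "shift_s k G = G" "shift_s k P = P" "shift_s k Q = Q" "shift_s k H' = H'" "shift_s k G' = G'" for k
    by (simp_all add: defs H'_G'_def shift_s_var_s)
  have rec: "of_int n * G - of_int m * H - of_int m * (T - of_int m * A) * G'
      + of_int n * (T - of_int n * A) * H' = of_int (n - m) * K"
    using arg_cong[OF H_families_recursion[OF assms(2), of n m], of "\<lambda>p. [:p:]"]
    by (simp add: defs H'_G'_def of_int_poly mult_ac)
  define g g' g'' where "g = shift_s (m + n) f" "g' = shift_s (m + n) (deriv_t f)"
    "g'' = shift_s (m + n) (deriv_t (deriv_t f))"
  have "Omega_L lam \<alpha> h m (Omega_L lam \<alpha> h n f) - Omega_L lam \<alpha> h n (Omega_L lam \<alpha> h m f)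
      = P * Q * ((of_int n * G - of_int m * H - of_int m * (T - of_int m * A) * G'
          + of_int n * (T - of_int n * A) * H') * g
        + of_int (n - m) * (S * g - of_int (m + n) * (T - of_int (m + n) * A) * g'))"
    unfolding Omega_L_eq defs[symmetric]
    by (simp add: shift_s_mult shift_s_diff shift_s_add shift_s_shift_s D shift
        deriv_t_mult deriv_t_diff deriv_t_add deriv_t_shift_s add.commute[of n m] g_g'_g''_def[symmetric])
      (simp add: algebra_simps)
  also have "\<dots> = of_int (n - m) * Omega_L lam \<alpha> h (m + n) f"
    unfolding rec Omega_L_eq powi_const_poly_ts[OF assms(1)] defs[symmetric] g_g'_g''_def[symmetric]
    by (simp add: algebra_simps)
  finally show ?thesis .
qed

text \<open>The bracket axiom is bilinear in the two Lie algebra elements, so it reduces to pairs of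
  basis elements.\<close>

lemma lie_module_Omega:
  assumes "lam \<noteq> 0" "h \<in> H_families \<alpha>"
  shows "lie_module w22_scale w22_bracket ts_scale (Omega_act lam \<alpha> h)"
proof -
  let ?\<rho> = "Omega_act lam \<alpha> h"
  have add_left: "?\<rho> (x + y) v = ?\<rho> x v + ?\<rho> y v" for x y v
    by (simp add: Omega_act_def ts.linear_extension_add)
  have add_right: "?\<rho> x (u + v) = ?\<rho> x u + ?\<rho> x v" for x u v
    by (simp add: Omega_act_def Omega_basis_act_add ts.linear_extension_add_fun)
  have scale_left: "?\<rho> (w22_scale c x) v = ts_scale c (?\<rho> x v)" for c x v
    by (simp add: Omega_act_def linear_extension_w22_scale vector_space_ts)
  have scale_right: "?\<rho> x (ts_scale c v) = ts_scale c (?\<rho> x v)" for c x v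
    by (simp add: Omega_act_def Omega_basis_act_scale ts.linear_extension_scale_fun)
  have basis: "?\<rho> (w22_elem a) v = Omega_basis_act lam \<alpha> h a v" for a v
    by (simp add: Omega_act_def)
  have minus_left: "?\<rho> (- x) v = - ?\<rho> x v" and zero_left: "?\<rho> 0 v = 0" for x v
    using scale_left[of "-1" x v] scale_left[of 0 x v] by simp_all
  have diff_left: "?\<rho> (x - y) v = ?\<rho> x v - ?\<rho> y v" for x y v
    using add_left[of x "- y"] by (simp add: minus_left)
  have zero_right: "?\<rho> x 0 = 0" for x
    using scale_right[of x 0 0] by simp
  \<comment> \<open>Analogue of \<open>w22_linear_zero\<close> with values in C[t,s].\<close>
  have linear_zero: "F x = 0"
    if "\<And>x y. F (x + y) = F x + F y" "\<And>c x. F (w22_scale c x) = ts_scale c (F x)"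
      "\<And>a. F (w22_elem a) = 0" for F :: "w22 \<Rightarrow> poly_ts" and x
  proof -
    have F0: "F 0 = 0" using that(1)[of 0 0] by simp
    have "F (sum g A) = (\<Sum>a\<in>A. F (g a))" for g and A :: "w22_basis set"
      by (induction A rule: infinite_finite_induct) (simp_all add: F0 that(1))
    then have "F x = (\<Sum>a\<in>Poly_Mapping.keys x. ts_scale (Poly_Mapping.lookup x a) (F (w22_elem a)))"
      by (subst w22_expand) (simp add: that(2))
    then show ?thesis by (simp add: that(3))
  qed
  have of_int_scale: "ts_scale (of_int k) f = of_int k * f" for k f
    by (simp add: ts_scale_eq_mult of_int_poly)
  \<comment> \<open>Cocycle terms vanish because \<open>C1\<close> and \<open>C2\<close> act as
    zero, which leaves the commutators of the operators.\<close>
  have bracket_basis: "?\<rho> (w22_basis_bracket a b) v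
      = ?\<rho> (w22_elem a) (?\<rho> (w22_elem b) v) - ?\<rho> (w22_elem b) (?\<rho> (w22_elem a) v)" for a b v
  proof (cases "(a, b)" rule: w22_basis_bracket.cases)
    case (1 m n)
    then show ?thesis
      using Omega_bracket_L_L[OF assms, of m n v] of_int_scale[of "n - m"]
      by (simp add: add_left scale_left basis)
  next
    case (2 m n)
    then show ?thesis
      using Omega_bracket_L_W[OF assms(1), of \<alpha> h m n v] of_int_scale[of "n - m"]
      by (simp add: add_left scale_left basis)
  next
    \<comment> \<open>This is the negative of the commutator of L_n with W_m, hence the exchanged
      indices.\<close>
    case (3 m n)
    have "?\<rho> (w22_basis_bracket (W m) (L n)) v = - (of_int (m - n) * Omega_W lam \<alpha> (n + m) v)"
      by (simp add: minus_left diff_left add_left scale_left basis of_int_scale add.commute[of m n]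
          del: of_int_diff)
    with 3 show ?thesis
      by (simp add: basis Omega_bracket_L_W[OF assms(1), of \<alpha> h n m v, symmetric] del: w22_basis_bracket.simps of_int_diff)
  \<comment> \<open>What remains is a pair of W's or a pair with a central element. The scalar 0
    instance says that each operator sends 0 to 0.\<close>
  qed (use Omega_basis_act_scale[of lam \<alpha> h _ 0] in
      \<open>simp_all add: basis zero_left zero_right Omega_bracket_W_W[of lam \<alpha>]\<close>)
  have "?\<rho> (w22_bracket x y) v - (?\<rho> x (?\<rho> y v) - ?\<rho> y (?\<rho> x v)) = 0" for x y v
  proof (rule linear_zero[where F = "\<lambda>x. ?\<rho> (w22_bracket x y) v - (?\<rho> x (?\<rho> y v) - ?\<rho> y (?\<rho> x v))"])
    fix a
    show "?\<rho> (w22_bracket (w22_elem a) y) v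
        - (?\<rho> (w22_elem a) (?\<rho> y v) - ?\<rho> y (?\<rho> (w22_elem a) v)) = 0"
      by (rule linear_zero[where F = "\<lambda>y. ?\<rho> (w22_bracket (w22_elem a) y) v
            - (?\<rho> (w22_elem a) (?\<rho> y v) - ?\<rho> y (?\<rho> (w22_elem a) v))"])
        (simp_all add: w22_bracket_linear add_left add_right scale_left scale_right
          w22_bracket_basis bracket_basis ts.scale_right_diff_distrib)
  qed (simp_all add: w22_bracket_linear add_left add_right scale_left scale_right
      ts.scale_right_diff_distrib)
  then show ?thesis
    by unfold_locales (simp_all add: add_left add_right scale_left scale_right)
qed

lemma Omega_act_elem: "Omega_act lam \<alpha> h (w22_elem a) f = Omega_basis_act lam \<alpha> h a f"
  by (simp add: Omega_act_def)

lemma Omega_act_cartan: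
  assumes "h \<in> H_families \<alpha>"
  shows "Omega_act lam \<alpha> h (w22_elem (L 0)) f = var_s * f"
    and "Omega_act lam \<alpha> h (w22_elem (W 0)) f = var_t * f"
  using assms by (simp_all add: Omega_act_elem Omega_L_eq Omega_W_eq H_families_zero one_pCons[symmetric])

section \<open>Freeness over \<open>U(\<complex>L\<^sub>0 \<oplus> \<complex>W\<^sub>0)\<close>\<close>

text \<open>Evaluation at x with coefficients mapped by \<phi>, in a possibly noncommutative target.
  Multiplying by x from the left makes the outer variable of a nested polynomial stand
  first.\<close>

definition horner :: "('a::zero \<Rightarrow> 'b::semiring_0) \<Rightarrow> 'b \<Rightarrow> 'a poly \<Rightarrow> 'b" where
  "horner \<phi> x p = fold_coeffs (\<lambda>a r. \<phi> a + x * r) p 0"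

lemma horner_0 [simp]: "horner \<phi> x 0 = 0"
  by (simp add: horner_def)

lemma horner_pCons: "\<phi> 0 = 0 \<Longrightarrow> horner \<phi> x (pCons a p) = \<phi> a + x * horner \<phi> x p"
  by (cases "p = 0 \<and> a = 0") (auto simp: horner_def)

lemma horner_add:
  assumes "\<And>a b. \<phi> (a + b) = \<phi> a + \<phi> b" "\<phi> 0 = 0"
  shows "horner \<phi> x (p + q) = horner \<phi> x p + horner \<phi> x q"
  by (induction p q rule: poly_induct2) (simp_all add: horner_pCons assms distrib_left add_ac)

text \<open>The ordered monomial \<open>L\<^sub>0\<^sup>i W\<^sub>0\<^sup>j\<close> stands for \<open>s\<^sup>i t\<^sup>j\<close>.\<close>

definition ordered_poly_t :: "complex poly \<Rightarrow> w22 list \<Rightarrow>\<^sub>0 complex" where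
  "ordered_poly_t = horner (Poly_Mapping.single []) (Poly_Mapping.single [w22_elem (W 0)] 1)"

definition ordered_poly :: "poly_ts \<Rightarrow> w22 list \<Rightarrow>\<^sub>0 complex" where
  "ordered_poly = horner ordered_poly_t (Poly_Mapping.single [w22_elem (L 0)] 1)"

lemma ordered_poly_t_0 [simp]: "ordered_poly_t 0 = 0"
  by (simp add: ordered_poly_t_def)

lemma ordered_poly_0 [simp]: "ordered_poly 0 = 0"
  by (simp add: ordered_poly_def)

lemma ordered_poly_t_pCons:
  "ordered_poly_t (pCons a p) =
     Poly_Mapping.single [] a + Poly_Mapping.single [w22_elem (W 0)] 1 * ordered_poly_t p"
  by (simp add: ordered_poly_t_def horner_pCons)

lemma ordered_poly_pCons:
  "ordered_poly (pCons c f) =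
     ordered_poly_t c + Poly_Mapping.single [w22_elem (L 0)] 1 * ordered_poly f"
  by (simp add: ordered_poly_def horner_pCons)

lemma ordered_poly_add: "ordered_poly (f + g) = ordered_poly f + ordered_poly g"
  by (simp add: ordered_poly_def ordered_poly_t_def horner_add single_add)

lemma ordered_poly_scale:
  "ordered_poly (ts_scale c f) = Poly_Mapping.single [] c * ordered_poly f"
proof -
  \<comment> \<open>Multiples of the empty word are central.\<close>
  have comm: "Poly_Mapping.single [] c * (Poly_Mapping.single [x] 1 * p)
      = Poly_Mapping.single [x] 1 * (Poly_Mapping.single [] c * p)" for x :: w22 and p
    by (simp add: mult.assoc[symmetric] mult_single plus_list_def)
  have "ordered_poly_t (smult c p) = Poly_Mapping.single [] c * ordered_poly_t p" for p
    by (induction p) (simp_all add: ordered_poly_t_pCons distrib_left comm mult_single plus_list_def)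
  then show ?thesis
    unfolding ts_scale_def by (induction f) (simp_all add: ordered_poly_pCons distrib_left comm)
qed

lemma cartan_elem: "w22_elem (L 0) \<in> w22_cartan" "w22_elem (W 0) \<in> w22_cartan"
  by (simp_all add: w22_cartan_def w22.span_base)

lemma ordered_poly_closed: "ordered_poly f \<in> carrier (free_algebra w22_cartan)"
proof -
  interpret F: ring "free_algebra w22_cartan :: (w22 list \<Rightarrow>\<^sub>0 complex) ring"
    by (rule ring_free_algebra)
  note closed = F.add.m_closed[simplified] F.zero_closed[simplified] free_algebra_mult_closed
    single_in_free_algebra cartan_elem
  have "ordered_poly_t p \<in> carrier (free_algebra w22_cartan)" for p
    by (induction p) (simp_all add: ordered_poly_t_pCons closed)
  then show ?thesis
    by (induction f) (simp_all add: ordered_poly_pCons closed)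
qed

section \<open>Rewriting modulo the defining relations\<close>

abbreviation cartan_ideal :: "(w22 list \<Rightarrow>\<^sub>0 complex) set" where
  "cartan_ideal \<equiv> Idl\<^bsub>free_algebra w22_cartan\<^esub> (w22.enveloping_relations w22_cartan)"

lemma ideal_cartan_ideal: "ideal cartan_ideal (free_algebra w22_cartan)"
  by (rule ring.genideal_ideal[OF ring_free_algebra])
    (rule w22.enveloping_relations_closed[OF w22_cartan_subalgebra])

lemma cartan_ideal_zero: "0 \<in> cartan_ideal"
  and cartan_ideal_add: "p \<in> cartan_ideal \<Longrightarrow> q \<in> cartan_ideal \<Longrightarrow> p + q \<in> cartan_ideal"
  and cartan_ideal_mult_left:
    "p \<in> cartan_ideal \<Longrightarrow> q \<in> carrier (free_algebra w22_cartan) \<Longrightarrow> q * p \<in> cartan_ideal"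
  and cartan_ideal_mult_right:
    "p \<in> cartan_ideal \<Longrightarrow> q \<in> carrier (free_algebra w22_cartan) \<Longrightarrow> p * q \<in> cartan_ideal"
proof -
  interpret I: ideal cartan_ideal "free_algebra w22_cartan" by (rule ideal_cartan_ideal)
  show "0 \<in> cartan_ideal" using additive_subgroup.zero_closed[OF I.additive_subgroup_axioms] by simp
  show "p + q \<in> cartan_ideal" if "p \<in> cartan_ideal" "q \<in> cartan_ideal"
    using additive_subgroup.a_closed[OF I.additive_subgroup_axioms that] by simp
  show "q * p \<in> cartan_ideal" "p * q \<in> cartan_ideal"
    if "p \<in> cartan_ideal" "q \<in> carrier (free_algebra w22_cartan)"
    using I.I_l_closed[OF that] I.I_r_closed[OF that] by simp_all
qed

lemma cartan_ideal_relation: "r \<in> w22.enveloping_relations w22_cartan \<Longrightarrow> r \<in> cartan_ideal"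
  using ring.genideal_self[OF ring_free_algebra
      w22.enveloping_relations_closed[OF w22_cartan_subalgebra]] by blast

lemma cartan_ideal_linear:
  assumes "x \<in> w22_cartan" "y \<in> w22_cartan"
  shows "Poly_Mapping.single [w22_scale a x + w22_scale b y] 1 - Poly_Mapping.single [x] a
    - Poly_Mapping.single [y] b \<in> cartan_ideal"
  by (rule cartan_ideal_relation) (use assms in \<open>auto simp: w22.enveloping_relations_def\<close>)

lemma cartan_ideal_commute:
  "Poly_Mapping.single [w22_elem (W 0)] 1 * Poly_Mapping.single [w22_elem (L 0)] 1
    - Poly_Mapping.single [w22_elem (L 0)] 1 * Poly_Mapping.single [w22_elem (W 0)] 1
    \<in> cartan_ideal"
proof -
  let ?l = "w22_elem (L 0)" and ?w = "w22_elem (W 0)"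
  have br: "w22_bracket ?w ?l = 0"
    by (simp add: w22_bracket_basis w22_cocycle_def)
  have "Poly_Mapping.single [?w, ?l] 1 - Poly_Mapping.single [?l, ?w] 1
      - Poly_Mapping.single [w22_bracket ?w ?l] 1 \<in> cartan_ideal"
    by (rule cartan_ideal_relation) (use cartan_elem in \<open>auto simp: w22.enveloping_relations_def\<close>)
  \<comment> \<open>The letter \<open>0\<close> is not the zero of the free algebra; the linearity
    relation with both scalars 0 puts it into the ideal.\<close>
  moreover have "Poly_Mapping.single [0 :: w22] 1 \<in> cartan_ideal"
    using cartan_ideal_linear[OF cartan_elem, of 0 0] by simp
  ultimately have "Poly_Mapping.single [?w, ?l] 1 - Poly_Mapping.single [?l, ?w] 1 \<in> cartan_ideal"
    using cartan_ideal_add unfolding br by fastforce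
  then show ?thesis
    by (simp add: mult_single plus_list_def)
qed

text \<open>Since L_0 stands first in ordered monomials, W_0 has to cross all its powers. Each
  crossing costs one commutator, which lies in the ideal.\<close>

lemma ordered_poly_mult_t:
  "Poly_Mapping.single [w22_elem (W 0)] 1 * ordered_poly f - ordered_poly (var_t * f) \<in> cartan_ideal"
proof (induction f)
  case 0
  then show ?case by (simp add: cartan_ideal_zero)
next
  case (pCons c f)
  let ?l = "Poly_Mapping.single [w22_elem (L 0)] (1 :: complex)"
  let ?w = "Poly_Mapping.single [w22_elem (W 0)] (1 :: complex)"
  have "?w * ordered_poly (pCons c f) - ordered_poly (var_t * pCons c f)
      = ?l * (?w * ordered_poly f - ordered_poly (var_t * f)) + (?w * ?l - ?l * ?w) * ordered_poly f"
    by (simp add: ordered_poly_pCons ordered_poly_t_pCons algebra_simps)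
  also have "\<dots> \<in> cartan_ideal"
    by (intro cartan_ideal_add cartan_ideal_mult_left cartan_ideal_mult_right pCons.IH
        cartan_ideal_commute ordered_poly_closed single_in_free_algebra) (simp add: cartan_elem)
  finally show ?case .
qed

section \<open>Evaluation at 1 and normal forms\<close>

context
  fixes lam \<alpha> :: complex and h :: "int \<Rightarrow> complex poly"
  assumes lam: "lam \<noteq> 0" and h: "h \<in> H_families \<alpha>"
begin

interpretation Omega: lie_module w22_scale w22_bracket ts_scale "Omega_act lam \<alpha> h"
  by (rule lie_module_Omega[OF lam h])

text \<open>Thus \<open>ordered_poly\<close> is a right inverse of evaluation at 1, which gives
  existence of coefficients.\<close>

lemma ordered_poly_act: "Omega.free_algebra_act (ordered_poly f) 1 = f"
proof -
  have const: "Omega.free_algebra_act (Poly_Mapping.single [] a) 1 = [:[:a:]:]" for a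
    by (subst Omega.free_algebra_act_single) (simp add: ts_scale_def)
  have t: "Omega.free_algebra_act (ordered_poly_t p) 1 = [:p:]" for p
    by (induction p) (simp_all add: ordered_poly_t_pCons Omega.free_algebra_act_add const
        Omega.free_algebra_act_mult Omega_act_cartan[OF h] del: Omega.free_algebra_act_single,
        simp add: Omega_act_cartan[OF h])
  show ?thesis
    by (induction f) (simp_all add: ordered_poly_pCons Omega.free_algebra_act_add
        Omega.free_algebra_act_mult Omega_act_cartan[OF h] t)
qed

text \<open>By induction on the word, only the prefixing of one letter to an already ordered
  polynomial has to be corrected.\<close>

lemma single_minus_ordered_poly:
  assumes "w \<in> lists w22_cartan"
  shows "Poly_Mapping.single w c - ordered_poly (Omega.free_algebra_act (Poly_Mapping.single w c) 1)
    \<in> cartan_ideal"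
  using assms
proof (induction w)
  case Nil
  have "ordered_poly (ts_scale c 1) = Poly_Mapping.single [] c"
    by (simp add: ts_scale_eq_mult ordered_poly_pCons ordered_poly_t_pCons)
  then show ?case by (simp add: cartan_ideal_zero)
next
  case (Cons x w)
  let ?l = "w22_elem (L 0)" and ?w = "w22_elem (W 0)"
  define g where "g = Omega.free_algebra_act (Poly_Mapping.single w c) 1"
  obtain a b where x: "x = w22_scale a ?l + w22_scale b ?w"
    using Cons.hyps(1) by (auto simp: w22_cartan_def w22.span_insert w22.span_singleton algebra_simps)
  have act: "Omega.free_algebra_act (Poly_Mapping.single (x # w) c) 1
      = ts_scale a (var_s * g) + ts_scale b (var_t * g)"
  proof -
    have "Omega.free_algebra_act (Poly_Mapping.single (x # w) c) 1 = Omega_act lam \<alpha> h x g"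
      by (simp add: g_def Omega.act_scale_right)
    then show ?thesis
      by (simp only: x Omega.act_add_left Omega.act_scale_left Omega_act_cartan[OF h])
  qed
  \<comment> \<open>Three errors arise: ordering the tail, splitting the letter x linearly, and
    moving W_0 into place. Each lies in the ideal.\<close>
  have "Poly_Mapping.single (x # w) c
        - ordered_poly (Omega.free_algebra_act (Poly_Mapping.single (x # w) c) 1)
      = Poly_Mapping.single [x] 1 * (Poly_Mapping.single w c - ordered_poly g)
        + (Poly_Mapping.single [x] 1 - Poly_Mapping.single [?l] a - Poly_Mapping.single [?w] b)
          * ordered_poly g
        + Poly_Mapping.single [] b * (Poly_Mapping.single [?w] 1 * ordered_poly g
          - ordered_poly (var_t * g))"
  proof -
    have split: "Poly_Mapping.single [y] d = Poly_Mapping.single [] d * Poly_Mapping.single [y] 1"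
      for y :: w22 and d :: complex
      by (simp add: mult_single plus_list_def)
    have "ordered_poly (var_s * g) = Poly_Mapping.single [?l] 1 * ordered_poly g"
      by (simp add: ordered_poly_pCons)
    then show ?thesis
      unfolding act unfolding ordered_poly_add ordered_poly_scale single_Cons[of x w] split[of ?l a] split[of ?w b]
      by (simp only: distrib_left distrib_right left_diff_distrib right_diff_distrib mult.assoc)
        (simp add: algebra_simps)
  qed
  also have "\<dots> \<in> cartan_ideal"
    by (intro cartan_ideal_add cartan_ideal_mult_left cartan_ideal_mult_right ordered_poly_closed
        Cons.IH[folded g_def] ordered_poly_mult_t single_in_free_algebra)
      (use Cons.hyps cartan_ideal_linear[OF cartan_elem] in \<open>simp_all add: x\<close>)
  finally show ?case .
qed

lemma minus_ordered_poly:
  assumes "p \<in> carrier (free_algebra w22_cartan)"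
  shows "p - ordered_poly (Omega.free_algebra_act p 1) \<in> cartan_ideal"
proof -
  \<comment> \<open>The defect \<open>D\<close> is additive, so single words suffice.\<close>
  define D where "D p = p - ordered_poly (Omega.free_algebra_act p 1)" for p
  have D_add: "D (p + q) = D p + D q" and D0: "D 0 = 0" for p q
    by (simp_all add: D_def Omega.free_algebra_act_add ordered_poly_add)
  have "D (\<Sum>w\<in>A. Poly_Mapping.single w (Poly_Mapping.lookup p w)) \<in> cartan_ideal"
    if "A \<subseteq> lists w22_cartan" for A
    using that
    by (induction A rule: infinite_finite_induct)
      (auto simp: D0 D_add cartan_ideal_zero intro!: cartan_ideal_add
        single_minus_ordered_poly[folded D_def])
  from this[of "Poly_Mapping.keys p"] show ?thesis
    using assms by (simp only: poly_mapping_sum_single[symmetric] carrier_free_algebra_iff D_def)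
qed

text \<open>Evaluation at 1 is surjective by \<open>ordered_poly_act\<close>, and by
  \<open>minus_ordered_poly\<close> the value at 1 determines the residue class.\<close>

lemma free_of_rank_Omega:
  "left_module.free_of_rank (w22.enveloping_algebra w22_cartan) Omega.enveloping_act 1"
proof -
  interpret U: left_module "w22.enveloping_algebra w22_cartan" Omega.enveloping_act
    by (rule Omega.left_module_enveloping[OF w22_cartan_subalgebra])
  interpret I: ideal cartan_ideal "free_algebra w22_cartan" by (rule ideal_cartan_ideal)
  let ?coset = "\<lambda>p. cartan_ideal +>\<^bsub>free_algebra w22_cartan\<^esub> p"
  note act_coset = Omega.enveloping_act_coset[OF w22_cartan_subalgebra]
  have eq_coset: "X = ?coset (ordered_poly v)"
    if X: "X \<in> carrier (w22.enveloping_algebra w22_cartan)" and v: "v = Omega.enveloping_act X 1" for X v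
  proof -
    obtain p where p: "p \<in> carrier (free_algebra w22_cartan)" "X = ?coset p"
      using X by (rule Omega.enveloping_algebra_coset)
    have "p - ordered_poly v \<in> cartan_ideal"
      using minus_ordered_poly[OF p(1)] by (simp add: v p act_coset)
    then have "p \<in> ?coset (ordered_poly v)"
      by (force simp: a_r_coset_free_algebra)
    then show ?thesis
      using I.a_repr_independence'[OF _ ordered_poly_closed] by (simp add: p)
  qed
  have closed: "?coset (ordered_poly v) \<in> carrier (w22.enveloping_algebra w22_cartan)" for v
    using ordered_poly_closed[of v]
    by (auto simp: w22.enveloping_algebra_def FactRing_def A_RCOSETS_def' a_r_coset_def')
  have "\<exists>!c. c \<in> {1} \<rightarrow>\<^sub>E carrier (w22.enveloping_algebra w22_cartan) \<and>
      v = (\<Sum>b\<in>{1}. Omega.enveloping_act (c b) b)" for v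
  \<comment> \<open>Coefficient functions are \<open>undefined\<close> off the basis, hence the
    restricted witness.\<close>
  proof (rule ex1I[of _ "\<lambda>b\<in>{1}. ?coset (ordered_poly v)"])
    fix c :: "poly_ts \<Rightarrow> (w22 list \<Rightarrow>\<^sub>0 complex) set"
    assume "c \<in> {1} \<rightarrow>\<^sub>E carrier (w22.enveloping_algebra w22_cartan) \<and>
      v = (\<Sum>b\<in>{1}. Omega.enveloping_act (c b) b)"
    then have c: "c \<in> {1} \<rightarrow>\<^sub>E carrier (w22.enveloping_algebra w22_cartan)"
      "v = Omega.enveloping_act (c 1) 1"
      by simp_all
    then have "c 1 = ?coset (ordered_poly v)"
      by (intro eq_coset) auto
    then show "c = (\<lambda>b\<in>{1}. ?coset (ordered_poly v))"
      using c(1) by (auto simp: PiE_def extensional_def fun_eq_iff)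
  qed (simp_all add: closed act_coset ordered_poly_closed ordered_poly_act)
  then have "U.finite_basis {1}"
    unfolding U.finite_basis_def by simp
  then show ?thesis
    unfolding U.free_of_rank_def by (intro exI[of _ "{1}"]) simp
qed

section \<open>Simplicity\<close>

text \<open>For \<alpha> = 0 the derivative enters L_m only through t times the t-derivative, which
  preserves the ideal (t), and W_m multiplies by t.\<close>

lemma not_simple_Omega:
  assumes "\<alpha> = 0"
  shows "\<not> Omega.simple"
proof -
  define T where "T = var_t"
  have dT: "deriv_t T = 1" and shift_T: "shift_s m T = T" for m
    by (simp_all add: T_def deriv_t_pCons pderiv_pCons one_pCons)
  have dTg: "deriv_t (T * g) = T * deriv_t g + g" for g
    by (simp add: deriv_t_mult dT)
  define N where "N = range ((*) T)"
  have sub: "ts.subspace N"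
  proof (rule ts.subspaceI)
    show "0 \<in> N" unfolding N_def by (rule range_eqI[of _ _ 0]) simp
  next
    fix x y
    assume "x \<in> N" "y \<in> N"
    then obtain f g where "x = T * f" "y = T * g" by (auto simp: N_def)
    then have "x + y = T * (f + g)" by (simp add: distrib_left)
    then show "x + y \<in> N" by (simp only: N_def rangeI)
  next
    fix c x
    assume "x \<in> N"
    then obtain f where "x = T * f" by (auto simp: N_def)
    then have "ts_scale c x = T * ts_scale c f" by (simp add: ts_scale_def)
    then show "ts_scale c x \<in> N" by (simp only: N_def rangeI)
  qed
  have "Omega_basis_act lam \<alpha> h a (T * g) \<in> N" for a g
  proof (cases a)
    case (L m)
    have "Omega_basis_act lam \<alpha> h a (T * g) = T * (const_poly_ts (lam powi m)
        * ((var_s + poly_in_t (h m)) * shift_s m g - of_int m * shift_s m (g + T * deriv_t g)))"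
      unfolding L Omega_basis_act.simps Omega_L_eq assms dTg shift_s_add shift_s_mult shift_T
        T_def[symmetric] pCons_0_0 mult_zero_right diff_0_right
      by (simp only: distrib_left right_diff_distrib mult_ac add_ac)
    then show ?thesis by (simp only: N_def rangeI)
  next
    case (W m)
    have "Omega_basis_act lam \<alpha> h a (T * g)
        = T * (const_poly_ts (lam powi m) * (T * shift_s m g))"
      unfolding W Omega_basis_act.simps Omega_W_eq assms shift_s_mult shift_T
        T_def[symmetric] pCons_0_0 mult_zero_right diff_0_right
      by (simp only: mult_ac)
    then show ?thesis by (simp only: N_def rangeI)
  qed (use ts.subspace_0[OF sub] in simp_all)
  then have "Omega_basis_act lam \<alpha> h a f \<in> N" if "f \<in> N" for a f
    using that by (auto simp: N_def)
  then have "Omega.lie_submodule N"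
    unfolding Omega.lie_submodule_def Omega_act_def linear_extension_def
    using sub by (blast intro: ts.subspace_sum ts.subspace_scale)
  moreover have "T \<in> N"
    unfolding N_def by (rule range_eqI[of _ _ 1]) simp
  then have "N \<noteq> {0}" by (auto simp: T_def)
  moreover have "1 \<notin> N"
  proof
    assume "1 \<in> N"
    then obtain g where "1 = var_t * g" by (auto simp: N_def T_def)
    \<comment> \<open>Evaluation at s = t = 0 yields 1 = 0.\<close>
    from arg_cong[OF this, of "\<lambda>f. poly (poly f 0) 0"] show False by simp
  qed
  then have "N \<noteq> UNIV" by blast
  ultimately show ?thesis
    unfolding Omega.simple_def by blast
qed

text \<open>If f were fixed by the shift, it would take the value f(0) at all natural numbers;
  having infinitely many roots over the domain C[t], f - f(0) would vanish. The degree drops because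
  the shift preserves the leading coefficient.\<close>

lemma shift_s_diff_degree:
  assumes "degree f > 0"
  shows "shift_s 1 f \<noteq> f" "degree (shift_s 1 f - f) < degree f"
proof -
  let ?q = "[:- 1, 1:] :: poly_ts"
  have shift: "shift_s 1 f = pcompose f ?q"
    by (simp add: shift_s_def one_pCons)
  show "shift_s 1 f \<noteq> f"
  proof
    assume eq: "shift_s 1 f = f"
    have step: "poly f x = poly f (x - 1)" for x
      using arg_cong[OF eq, of "\<lambda>g. poly g x"] by (simp add: shift poly_pcompose)
    have "poly f (of_nat n) = poly f 0" for n
      by (induction n) (simp_all add: step[of "1 + _"])
    then have "range of_nat \<subseteq> {x. poly (f - [:poly f 0:]) x = 0}" by auto
    moreover have "infinite (range (of_nat :: nat \<Rightarrow> complex poly))"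
      by (rule range_inj_infinite) (rule inj_of_nat)
    ultimately have "f - [:poly f 0:] = 0"
      using poly_roots_finite finite_subset by blast
    then have "f = [:poly f 0:]" by simp
    then show False using assms by (metis degree_pCons_0 less_irrefl)
  qed
  have deg: "degree (shift_s 1 f) = degree f"
    by (simp add: shift degree_pcompose)
  have "coeff (shift_s 1 f) (degree f) = coeff f (degree f)"
    using lead_coeff_comp[of ?q f] by (simp add: shift degree_pcompose)
  then have "coeff (shift_s 1 f - f) (degree f) = 0" by simp
  moreover have "degree (shift_s 1 f - f) \<le> degree f"
    using degree_diff_le[of "shift_s 1 f" "degree f" f] deg by simp
  \<comment> \<open>Equal degrees would make the difference 0, whose degree 0 lies below that of
    f.\<close>
  ultimately show "degree (shift_s 1 f - f) < degree f"
    using assms by (metis degree_0 le_neq_implies_less leading_coeff_0_iff)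
qed

lemma simple_Omega:
  assumes \<alpha>: "\<alpha> \<noteq> 0"
  shows "Omega.simple"
proof -
  have "N = UNIV" if N: "Omega.lie_submodule N" "N \<noteq> {0}" for N
  proof -
    have sub: "ts.subspace N" and act: "\<And>a f. f \<in> N \<Longrightarrow> Omega_basis_act lam \<alpha> h a f \<in> N"
      using N(1) unfolding Omega.lie_submodule_def by (simp, metis Omega_act_elem)
    have add: "f + g \<in> N" and diff: "f - g \<in> N" if "f \<in> N" "g \<in> N" for f g
      using that sub by (simp_all add: ts.subspace_add ts.subspace_diff)
    have const: "const_poly_ts c * f \<in> N" if "f \<in> N" for c f
      using ts.subspace_scale[OF sub that, of c] by (simp add: ts_scale_eq_mult)
    have s: "var_s * f \<in> N" and t: "var_t * f \<in> N" if "f \<in> N" for f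
      using act[OF that, of "L 0"] act[OF that, of "W 0"] Omega_act_cartan[OF h, of lam f]
      by (simp_all only: Omega_act_elem)
    have mult: "g * f \<in> N" if "f \<in> N" for f g
    proof -
      have t': "[:p:] * f \<in> N" for p
      proof (induction p)
        case 0
        then show ?case using ts.subspace_0[OF sub] by simp
      next
        case (pCons a p)
        have "[:pCons a p:] * f = const_poly_ts a * f + var_t * ([:p:] * f)"
          by (simp flip: smult_add_left)
        then show ?case using add const t pCons.IH that by metis
      qed
      show ?thesis
      proof (induction g)
        case 0
        then show ?case using ts.subspace_0[OF sub] by simp
      next
        case (pCons a g)
        have "pCons a g * f = [:a:] * f + var_s * (g * f)" by simp
        then show ?case using add t' s pCons.IH by metis
      qed
    qed
    have cancel: "g \<in> N" if "const_poly_ts c * g \<in> N" "c \<noteq> 0" for c g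
    proof -
      have "const_poly_ts (inverse c) * (const_poly_ts c * g) = g"
        using that(2) by (simp add: one_pCons[symmetric])
      then show ?thesis using const[OF that(1)] by metis
    qed
    have powi: "lam powi m \<noteq> 0" for m using lam by simp
    have "\<exists>f. f \<in> N \<and> f \<noteq> 0"
      using N(2) ts.subspace_0[OF sub] by blast
    \<comment> \<open>The descent in s is phrased through an element of least s-degree.\<close>
    then obtain f where f: "f \<in> N" "f \<noteq> 0" and f_min: "\<And>g. g \<in> N \<Longrightarrow> g \<noteq> 0 \<Longrightarrow> degree f \<le> degree g"
      using ex_has_least_nat[of "\<lambda>f. f \<in> N \<and> f \<noteq> 0" _ degree] by blast
    have "degree f = 0"
    proof (rule ccontr)
      assume "degree f \<noteq> 0"
      then have deg: "degree f > 0" by simp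
      have "(var_t - of_int 1 * const_poly_ts \<alpha>) * shift_s 1 f \<in> N"
        by (rule cancel[OF _ powi]) (use act[OF f(1), of "W 1"] in \<open>simp only: Omega_basis_act.simps Omega_W_eq\<close>)
      moreover have "(var_t - of_int 1 * const_poly_ts \<alpha>) * f \<in> N"
        by (rule mult[OF f(1)])
      ultimately have "(var_t - of_int 1 * const_poly_ts \<alpha>) * (shift_s 1 f - f) \<in> N"
        using diff by (metis right_diff_distrib)
      \<comment> \<open>The factor t - \<alpha> is a nonzero element of C[t], so it leaves the
        s-degree unchanged and the product contradicts minimality.\<close>
      then have "smult [:- \<alpha>, 1:] (shift_s 1 f - f) \<in> N" by simp
      with f_min[of "smult [:- \<alpha>, 1:] (shift_s 1 f - f)"] shift_s_diff_degree[OF deg]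
      show False by simp
    qed
    then obtain p0 where p0: "f = [:p0:]" by (rule degree_eq_zeroE)
    then have "\<exists>p. [:p:] \<in> N \<and> p \<noteq> 0" using f by auto
    then obtain p where p: "[:p:] \<in> N" "p \<noteq> 0"
      and p_min: "\<And>q. [:q:] \<in> N \<Longrightarrow> q \<noteq> 0 \<Longrightarrow> degree p \<le> degree q"
      using ex_has_least_nat[of "\<lambda>p. [:p:] \<in> N \<and> p \<noteq> 0" _ degree] by blast
    \<comment> \<open>The shift fixes p(t), and L_m p differs from this element by sign and the
      ideal multiple (s + h_m) p, up to the factor \<lambda>^m.\<close>
    have deriv: "of_int m * (var_t - of_int m * const_poly_ts \<alpha>) * [:pderiv p:] \<in> N" for m
    proof -
      have "(var_s + poly_in_t (h m)) * [:p:]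
          - of_int m * (var_t - of_int m * const_poly_ts \<alpha>) * [:pderiv p:] \<in> N"
      proof (rule cancel[OF _ powi])
        show "const_poly_ts (lam powi m) * ((var_s + poly_in_t (h m)) * [:p:]
            - of_int m * (var_t - of_int m * const_poly_ts \<alpha>) * [:pderiv p:]) \<in> N"
          using act[OF p(1), of "L m"]
          by (simp only: Omega_basis_act.simps Omega_L_eq deriv_t_pCons deriv_t_0 shift_s_const)
      qed
      from diff[OF mult[OF p(1), of "var_s + poly_in_t (h m)"] this] show ?thesis
        by (simp only: diff_diff_eq2 add_diff_cancel_left')
    qed
    \<comment> \<open>Doubling the case m = 1 and subtracting the case m = 2 eliminates t: 2(t -
      \<alpha>) - 2(t - 2\<alpha>) = 2\<alpha>.\<close>
    have "const_poly_ts (2 * \<alpha>) * [:pderiv p:]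
        = 2 * (of_int 1 * (var_t - of_int 1 * const_poly_ts \<alpha>) * [:pderiv p:])
          - of_int 2 * (var_t - of_int 2 * const_poly_ts \<alpha>) * [:pderiv p:]"
      by (simp add: numeral_poly algebra_simps)
    also have "\<dots> \<in> N"
      by (intro diff mult deriv)
    finally have dp: "[:pderiv p:] \<in> N"
      by (rule cancel) (use \<alpha> in simp)
    \<comment> \<open>A nonzero p' would give degree p \<le> degree p - 1, which in truncated
      subtraction forces degree 0; if p' = 0, then p is constant in characteristic 0.\<close>
    have "degree p = 0"
      using p_min[OF dp] degree_pderiv[of p] by (cases "pderiv p = 0") (auto simp: pderiv_eq_0_iff)
    then obtain c where c: "p = [:c:]" by (rule degree_eq_zeroE)
    have "1 \<in> N"
      by (rule cancel[of c]) (use p c in simp_all)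
    then show "N = UNIV" using mult[of 1] by auto
  qed
  moreover have "(1 :: poly_ts) \<noteq> 0" by simp
  ultimately show ?thesis
    unfolding Omega.simple_def by blast
qed

end

theorem proposition3p1:
  fixes lam \<alpha> :: complex and h :: "int \<Rightarrow> complex poly"
  assumes "lam \<noteq> 0" and "h \<in> H_families \<alpha>"
  shows "lie_module w22_scale w22_bracket ts_scale (Omega_act lam \<alpha> h) \<and>
    left_module (w22.enveloping_algebra w22_cartan)
      (lie_module.enveloping_act ts_scale (Omega_act lam \<alpha> h)) \<and>
    left_module.free_of_rank (w22.enveloping_algebra w22_cartan)
      (lie_module.enveloping_act ts_scale (Omega_act lam \<alpha> h)) 1 \<and>
    (lie_module.simple ts_scale (Omega_act lam \<alpha> h) \<longleftrightarrow> \<alpha> \<noteq> 0)"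
proof -
  have mod: "lie_module w22_scale w22_bracket ts_scale (Omega_act lam \<alpha> h)"
    by (rule lie_module_Omega[OF assms])
  show ?thesis
    using mod lie_module.left_module_enveloping[OF mod w22_cartan_subalgebra]
      free_of_rank_Omega[OF assms] simple_Omega[OF assms] not_simple_Omega[OF assms]
    by blast
qed

end
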